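(* Let $u\in C^{2}(\mathbb{R}^{2})$ satisfy, at every point of $\mathbb{R}^2$, $$(u_{y}+x)^{2}u_{xx}-2(u_{y}+x)(u_{x}-y)u_{xy}+(u_{x}-y)^{2}u_{yy}=0 .$$ Then $u$ is of one of the following two forms: (1) $u(x,y)=ax+by+c$ for real constants $a,b,c$; or (2) $u(x,y)=-abx^{2}+(a^{2}-b^{2})xy+aby^{2}+g(-bx+ay)$ for real constants $a,b$ with $a^{2}+b^{2}=1$ and some function $g\in C^{2}(\mathbb{R})$.
   Context: The displayed equation is the p-minimal graph equation for the graph $\{(x,y,u(x,y))\}$ in the 3-dimensional Heisenberg group $H_1$ (identified with $\mathbb{R}^3$, with contact form $dz+x\,dy-y\,dx$). *)

theory Defs
  imports "HOL-Analysis.Analysis"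
begin

definition px :: "(real \<times> real \<Rightarrow> real) \<Rightarrow> real \<times> real \<Rightarrow> real" where
  "px f = (\<lambda>(x, y). deriv (\<lambda>s. f (s, y)) x)"

definition py :: "(real \<times> real \<Rightarrow> real) \<Rightarrow> real \<times> real \<Rightarrow> real" where
  "py f = (\<lambda>(x, y). deriv (\<lambda>t. f (x, t)) y)"

definition C1_plane :: "(real \<times> real \<Rightarrow> real) \<Rightarrow> bool" where
  "C1_plane f \<longleftrightarrow> (\<forall>p. f differentiable (at p)) \<and>
     continuous_on UNIV (px f) \<and> continuous_on UNIV (py f)"

definition C2_plane :: "(real \<times> real \<Rightarrow> real) \<Rightarrow> bool" where
  "C2_plane f \<longleftrightarrow> C1_plane f \<and> C1_plane (px f) \<and> C1_plane (py f)"

definition C2_line :: "(real \<Rightarrow> real) \<Rightarrow> bool" where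
  "C2_line g \<longleftrightarrow> (\<forall>t. g differentiable (at t)) \<and> (\<forall>t. deriv g differentiable (at t)) \<and>
     continuous_on UNIV (deriv (deriv g))"

end

theory Submission
  imports Defs
begin

text \<open>
  With \<open>F = (u\<^sub>x - y, u\<^sub>y + x)\<close> the equation says that the direction of \<open>F\<close> is constant along the
  lines orthogonal to \<open>F\<close>, as long as \<open>F \<noteq> 0\<close>. Along such a line \<open>u\<close> is affine, and comparing \<open>u\<close> on
  neighbouring lines gives \<open>F (P + s J) = (1 + 2 s + K s\<^sup>2) / (1 + K s) F P\<close>, where \<open>J\<close> is \<open>F P\<close> turned
  by a right angle and \<open>K\<close> is the scaled curvature of the direction field. Since \<open>F\<close> does not blow
  up, \<open>0 \<le> K \<le> 1\<close> and the line runs into exactly one zero of \<open>F\<close>. If \<open>K < 1\<close>, the zeros form a curve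
  there, which the line crosses; then the formula holds for all \<open>s\<close>, and the pole at
  \<open>s = - 1 / K\<close> forces \<open>K = 0\<close>. So \<open>K\<close> is 0 or 1. If \<open>K = 1\<close> somewhere, all lines emanate from one
  point and \<open>u\<close> is affine; if \<open>K = 0\<close> everywhere, all lines are parallel, which is form (2).
\<close>

section \<open>Rotation, determinant and orthogonal frames in the plane\<close>

definition rot :: "real \<times> real \<Rightarrow> real \<times> real" where
  "rot z = (snd z, - fst z)"

definition cross2 :: "real \<times> real \<Rightarrow> real \<times> real \<Rightarrow> real" where
  "cross2 v w = fst v * snd w - snd v * fst w"

lemma inner_pair: "v \<bullet> w = fst v * fst w + snd v * snd w" for v w :: "real \<times> real"
  by (simp add: inner_prod_def)

lemma rot_inner_rot [simp]: "rot v \<bullet> rot w = v \<bullet> w"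
  by (simp add: inner_pair rot_def)

lemma inner_rot_self [simp]: "v \<bullet> rot v = 0" "rot v \<bullet> v = 0"
  by (simp_all add: inner_pair rot_def)

lemma rot_inner: "rot v \<bullet> w = - (v \<bullet> rot w)"
  by (simp add: inner_pair rot_def)

lemma rot_rot [simp]: "rot (rot v) = - v"
  by (simp add: rot_def prod_eq_iff)

lemma rot_scaleR: "rot (c *\<^sub>R v) = c *\<^sub>R rot v"
  by (simp add: rot_def)

lemma rot_add: "rot (v + w) = rot v + rot w"
  by (simp add: rot_def)

lemma norm_rot [simp]: "norm (rot v) = norm v"
  by (simp add: norm_eq_sqrt_inner)

lemma rot_eq_0_iff [simp]: "rot v = 0 \<longleftrightarrow> v = 0"
  by (auto simp: rot_def prod_eq_iff)

lemma bounded_linear_rot: "bounded_linear rot"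
  by (rule bounded_linear_intro[where K = 1]) (auto simp: rot_add rot_scaleR)

lemmas rot_has_derivative [derivative_intros] = bounded_linear.has_derivative[OF bounded_linear_rot]
lemmas continuous_on_rot [continuous_intros] = bounded_linear.continuous_on[OF bounded_linear_rot]
lemmas continuous_rot [continuous_intros] = bounded_linear.continuous[OF bounded_linear_rot]

lemma bounded_bilinear_cross2: "bounded_bilinear cross2"
proof
  show "\<exists>K. \<forall>a b. norm (cross2 a b) \<le> norm a * norm b * K"
  proof (intro exI allI)
    fix a b :: "real \<times> real"
    have "cross2 a b = - (a \<bullet> rot (- b))" by (simp add: cross2_def inner_pair rot_def)
    also have "\<bar>\<dots>\<bar> \<le> norm a * norm b" using Cauchy_Schwarz_ineq2[of a "rot (- b)"] by simp
    finally show "norm (cross2 a b) \<le> norm a * norm b * 1" by simp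
  qed
qed (auto simp: cross2_def algebra_simps)

lemmas cross2_has_derivative [derivative_intros] =
  bounded_bilinear.FDERIV[OF bounded_bilinear_cross2]

lemma orthogonal_decomp:
  fixes f z :: "real \<times> real"
  assumes "f \<noteq> 0"
  shows "z = ((z \<bullet> f) / (f \<bullet> f)) *\<^sub>R f + ((z \<bullet> rot f) / (f \<bullet> f)) *\<^sub>R rot f"
proof -
  have *: "(f \<bullet> f) *\<^sub>R z = (z \<bullet> f) *\<^sub>R f + (z \<bullet> rot f) *\<^sub>R rot f"
    by (simp add: inner_pair rot_def prod_eq_iff algebra_simps)
  have "z = (1 / (f \<bullet> f)) *\<^sub>R ((f \<bullet> f) *\<^sub>R z)" using assms by simp
  then show ?thesis unfolding * by (simp add: scaleR_add_right)
qed

lemma parallel_if_orthogonal_rot: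
  fixes f z :: "real \<times> real"
  assumes "f \<noteq> 0" "z \<bullet> rot f = 0"
  shows "z = ((z \<bullet> f) / (f \<bullet> f)) *\<^sub>R f"
  using orthogonal_decomp[OF assms(1), of z] assms(2) by simp

section \<open>One-variable tools: a linear differential equation and limits at end points\<close>

text \<open>Gronwall's argument: with \<open>C\<close> a bound for the coefficient \<open>m\<close>,
  the weighted square of \<open>b\<close> in \<open>f\<close> cannot increase from its initial value
  0.\<close>

lemma linear_ode_zero:
  fixes b m :: "real \<Rightarrow> real"
  assumes b: "\<And>t. t \<in> {0..1} \<Longrightarrow> (b has_real_derivative b t * m t) (at t)"
    and m: "continuous_on {0..1} m" and b0: "b 0 = 0"
  shows "b 1 = 0"
proof -
  have "bounded (m ` {0..1})" using m by (intro compact_imp_bounded compact_continuous_image) auto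
  then obtain C where C: "\<And>t. t \<in> {0..1} \<Longrightarrow> \<bar>m t\<bar> \<le> C"
    unfolding bounded_iff by (force simp: image_iff)
  define f where "f = (\<lambda>t. (b t)\<^sup>2 * exp (- 2 * C * t))"
  have "f 1 \<le> f 0"
  proof (rule DERIV_nonpos_imp_nonincreasing[of 0 1 f])
    fix t :: real assume t: "0 \<le> t" "t \<le> 1"
    have "(f has_real_derivative 2 * (b t)\<^sup>2 * exp (- 2 * C * t) * (m t - C)) (at t)"
      unfolding f_def using t
      by (auto intro!: derivative_eq_intros b simp: power2_eq_square algebra_simps)
    moreover have "2 * (b t)\<^sup>2 * exp (- 2 * C * t) * (m t - C) \<le> 0"
      using C[of t] t by (intro mult_nonneg_nonpos) auto
    ultimately show "\<exists>y. (f has_real_derivative y) (at t) \<and> y \<le> 0" by blast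
  qed simp
  then have "(b 1)\<^sup>2 * exp (- 2 * C) \<le> 0" by (simp add: f_def b0)
  then show ?thesis by (simp add: mult_le_0_iff)
qed

lemma constant_at_left_end:
  fixes f :: "real \<Rightarrow> 'b::t1_space"
  assumes "continuous_on {a..} f" "\<And>x. x > a \<Longrightarrow> f x = c" "x \<ge> a"
  shows "f x = c"
  using continuous_constant_on_closure[of "{a<..}" f c x] assms by simp

lemma constant_at_right_end:
  fixes f :: "real \<Rightarrow> 'b::t1_space"
  assumes "continuous_on {a..b} f" "\<And>x. a \<le> x \<Longrightarrow> x < b \<Longrightarrow> f x = c" "a < b"
  shows "f b = c"
  using continuous_constant_on_closure[of "{a..<b}" f c b] assms by simp

lemma isCont_eventually_pos:
  fixes f :: "'a::t2_space \<Rightarrow> real"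
  assumes "isCont f a" "f a > 0"
  shows "\<forall>\<^sub>F x in nhds a. f x > 0"
proof -
  have "(f \<longlongrightarrow> f a) (nhds a)"
    using assms(1) unfolding isCont_def tendsto_at_iff_tendsto_nhds .
  then show ?thesis using assms(2) by (rule order_tendstoD)
qed

subsection \<open>Characteristic lines\<close>

text \<open>Since \<open>F\<close> is the gradient of \<open>u\<close> plus \<open>(- y, x)\<close>,
  its differential \<open>A\<close> is the Hessian plus a quarter turn. The quarter turn produces
  the curl 2 and drops out of \<open>eqn\<close>, which is thus the Hessian of \<open>u\<close>
  evaluated on the characteristic direction \<open>rot F\<close>.\<close>

locale p_minimal =
  fixes u :: "real \<times> real \<Rightarrow> real"
    and F :: "real \<times> real \<Rightarrow> real \<times> real"
    and A :: "real \<times> real \<Rightarrow> real \<times> real \<Rightarrow> real \<times> real"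
  assumes du: "(u has_derivative (\<lambda>v. F P \<bullet> v - cross2 P v)) (at P)"
    and dF: "(F has_derivative A P) (at P)"
    and contA: "continuous_on UNIV (\<lambda>P. A P v)"
    and curl: "w \<bullet> A P v - v \<bullet> A P w = 2 * cross2 v w"
    and eqn: "rot (F P) \<bullet> A P (rot (F P)) = 0"
begin

lemma linear_A: "linear (A P)"
  using dF has_derivative_linear by blast

lemmas A_add = linear_add[OF linear_A] and A_scaleR = linear_scale[OF linear_A]
  and A_diff = linear_diff[OF linear_A]

lemma A_expand: "A P v = fst v *\<^sub>R A P (1, 0) + snd v *\<^sub>R A P (0, 1)"
proof -
  have "v = fst v *\<^sub>R (1, 0) + snd v *\<^sub>R (0, 1)" by (simp add: prod_eq_iff)
  then show ?thesis by (metis A_add A_scaleR)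
qed

text \<open>Joint continuity reduces to continuity in the point, because \<open>A\<close> is linear
  in the vector and determined by its two columns.\<close>

lemma continuous_on_A [continuous_intros]:
  assumes "continuous_on S f" "continuous_on S g"
  shows "continuous_on S (\<lambda>x. A (f x) (g x))"
proof -
  have "continuous_on S (\<lambda>x. A (f x) v)" for v
    using continuous_on_compose2[OF contA assms(1)] by auto
  then show ?thesis
    by (subst A_expand) (intro continuous_intros assms)
qed

lemma continuous_on_F [continuous_intros]:
  "continuous_on S f \<Longrightarrow> continuous_on S (\<lambda>x. F (f x))"
  by (rule continuous_on_compose2[of UNIV])
     (auto intro: has_derivative_continuous_on[OF has_derivative_at_withinI[OF dF]])

lemma F_has_derivative [derivative_intros]:
  assumes "(f has_derivative f') (at x within S)"
  shows "((\<lambda>x. F (f x)) has_derivative (\<lambda>v. A (f x) (f' v))) (at x within S)"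
  using has_derivative_compose[OF assms dF] .

lemma F_line_has_vector_derivative:
  "((\<lambda>t. F (P + t *\<^sub>R v)) has_vector_derivative A (P + t *\<^sub>R v) v) (at t within S)"
  unfolding has_vector_derivative_def
  by (auto intro!: derivative_eq_intros simp: A_scaleR)

lemma inner_F_line_has_derivative:
  "((\<lambda>t. F (P + (t * s) *\<^sub>R v) \<bullet> w) has_real_derivative s * (A (P + (t * s) *\<^sub>R v) v \<bullet> w)) (at t)"
  unfolding has_field_derivative_def
  by (auto intro!: derivative_eq_intros simp: A_scaleR fun_eq_iff)

text \<open>With \<open>F = (a f + b j) / |f|\<^sup>2\<close> along the line, the equation reads
  \<open>a\<^sup>2 b' = b (\<dots>)\<close>, a linear homogeneous equation for \<open>b\<close> as long as \<open>a\<close> does not vanish.\<close>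

lemma straight:
  assumes pos: "\<And>t. t \<in> {0..1} \<Longrightarrow> F (P + (t * s) *\<^sub>R rot (F P)) \<bullet> F P > 0"
  shows "F (P + s *\<^sub>R rot (F P)) \<bullet> rot (F P) = 0"
proof -
  define f where "f = F P"
  define j where "j = rot f"
  define X where "X = (\<lambda>t. P + (t * s) *\<^sub>R j)"
  define a where "a = (\<lambda>t. F (X t) \<bullet> f)"
  define b where "b = (\<lambda>t. F (X t) \<bullet> j)"
  define c where "c = (\<lambda>t. s * (a t * (j \<bullet> A (X t) f + f \<bullet> A (X t) j) - b t * (f \<bullet> A (X t) f)))"
  have f0: "f \<noteq> 0" using pos[of 0] by (auto simp: f_def)
  have apos: "a t > 0" if "t \<in> {0..1}" for t
    using pos[OF that] by (simp add: a_def X_def f_def j_def)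
  have eq: "(a t)\<^sup>2 * (j \<bullet> A (X t) j)
     = b t * (a t * (j \<bullet> A (X t) f + f \<bullet> A (X t) j) - b t * (f \<bullet> A (X t) f))" for t
  proof -
    define k where "k = f \<bullet> f"
    have k: "k \<noteq> 0" using f0 by (simp add: k_def)
    have "F (X t) = (a t / k) *\<^sub>R f + (b t / k) *\<^sub>R j"
      using orthogonal_decomp[OF f0, of "F (X t)"] by (simp add: a_def b_def j_def k_def)
    then have r: "rot (F (X t)) = (a t / k) *\<^sub>R j - (b t / k) *\<^sub>R f"
      by (simp add: rot_add rot_scaleR j_def)
    then have r: "k *\<^sub>R rot (F (X t)) = a t *\<^sub>R j - b t *\<^sub>R f"
      using k by (simp add: scaleR_diff_right)
    have "(k *\<^sub>R rot (F (X t))) \<bullet> A (X t) (k *\<^sub>R rot (F (X t))) = 0"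
      using eqn[of "X t"] by (simp add: A_scaleR)
    then show ?thesis unfolding r
      by (simp add: A_diff A_scaleR inner_diff_left inner_diff_right power2_eq_square algebra_simps)
  qed
  have "b 1 = 0"
  proof (rule linear_ode_zero[where m = "\<lambda>t. c t / (a t)\<^sup>2"])
    fix t :: real assume t: "t \<in> {0..1}"
    have "(b has_real_derivative s * (A (X t) j \<bullet> j)) (at t)"
      unfolding b_def X_def by (rule inner_F_line_has_derivative)
    moreover have "s * (A (X t) j \<bullet> j) = b t * (c t / (a t)\<^sup>2)"
    proof -
      have "s * ((a t)\<^sup>2 * (j \<bullet> A (X t) j)) = b t * c t"
        unfolding eq by (simp add: c_def)
      then show ?thesis using apos[OF t] by (simp add: nonzero_eq_divide_eq inner_commute mult_ac)
    qed
    ultimately show "(b has_real_derivative b t * (c t / (a t)\<^sup>2)) (at t)" by simp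
  next
    show "continuous_on {0..1} (\<lambda>t. c t / (a t)\<^sup>2)"
    proof (intro continuous_on_divide continuous_on_power ballI)
      show "continuous_on {0..1} c" "continuous_on {0..1} a"
        unfolding a_def b_def c_def X_def by (intro continuous_intros)+
    qed (use apos in force)
  qed (simp add: b_def X_def j_def f_def)
  then show ?thesis by (simp add: b_def X_def j_def f_def)
qed

section \<open>The formula for \<open>F\<close> along a characteristic line\<close>

text \<open>This is \<open>norm (F P)\<close> times the signed curvature at \<open>P\<close> of the
  integral curve of \<open>F\<close>: the numerator is the determinant of \<open>F P\<close> and
  \<open>A P (F P)\<close>. To first order, neighbouring lines orthogonal to \<open>F\<close> meet
  at parameter \<open>- 1 / K P\<close>.\<close>

definition K :: "real \<times> real \<Rightarrow> real" where
  "K P = - (rot (F P) \<bullet> A P (F P)) / (F P \<bullet> F P)"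

lemma K_eq: "F P \<noteq> 0 \<Longrightarrow> rot (F P) \<bullet> A P (F P) = - K P * (F P \<bullet> F P)"
  by (simp add: K_def)

lemma K_eq': "F P \<noteq> 0 \<Longrightarrow> F P \<bullet> rot (A P (F P)) = K P * (F P \<bullet> F P)"
  using K_eq[of P] by (simp add: rot_inner)

text \<open>The hypothesis makes \<open>u\<close> affine along the segments issuing from all points
  near \<open>P\<close>. Differentiating this identity with respect to the starting point, in
  direction \<open>F P\<close>, gives one scalar equation for \<open>F\<close> at the end point,
  where its direction is already known.\<close>

lemma line_formula:
  assumes f0: "F P \<noteq> 0"
    and ev: "\<forall>\<^sub>F P' in nhds P. \<forall>t\<in>{0..1}. F (P' + (t * s) *\<^sub>R rot (F P')) \<bullet> rot (F P') = 0"
  shows "(1 + K P * s) *\<^sub>R F (P + s *\<^sub>R rot (F P)) = (1 + 2 * s + K P * s\<^sup>2) *\<^sub>R F P"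
proof -
  define f where "f = F P"
  define Q where "Q = P + s *\<^sub>R rot f"
  define W where "W = rot (A P f)"
  have ev': "\<forall>\<^sub>F P' in nhds P. u (P' + s *\<^sub>R rot (F P')) = u P' - s * cross2 P' (rot (F P'))"
    using ev
  proof eventually_elim
    case (elim P')
    define j where "j = rot (F P')"
    \<comment> \<open>Along the segment the \<open>F\<close> term in the differential of
      \<open>u\<close> vanishes by \<open>elim\<close>, and \<open>cross2\<close> of the moving
      point with \<open>j\<close> keeps its value at \<open>P'\<close>; hence \<open>h\<close> is
      constant.\<close>
    define h where "h = (\<lambda>t. u (P' + (t * s) *\<^sub>R j) + t * (s * cross2 P' j))"
    have "h 1 = h 0"
    proof (rule has_derivative_zero_unique[of "{0..1}" h 1 0])
      fix t :: real assume t: "t \<in> {0..1}"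
      have "((\<lambda>t. u (P' + (t * s) *\<^sub>R j)) has_derivative
          (\<lambda>r. F (P' + (t * s) *\<^sub>R j) \<bullet> ((r * s) *\<^sub>R j) - cross2 (P' + (t * s) *\<^sub>R j) ((r * s) *\<^sub>R j)))
          (at t within {0..1})"
        by (rule has_derivative_compose[OF _ du]) (auto intro!: derivative_eq_intros)
      then have "(h has_derivative (\<lambda>r. F (P' + (t * s) *\<^sub>R j) \<bullet> ((r * s) *\<^sub>R j)
           - cross2 (P' + (t * s) *\<^sub>R j) ((r * s) *\<^sub>R j) + r * (s * cross2 P' j))) (at t within {0..1})"
        unfolding h_def by (auto intro!: derivative_eq_intros)
      moreover have "(\<lambda>r. F (P' + (t * s) *\<^sub>R j) \<bullet> ((r * s) *\<^sub>R j)
           - cross2 (P' + (t * s) *\<^sub>R j) ((r * s) *\<^sub>R j) + r * (s * cross2 P' j)) = (\<lambda>r. 0)"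
        using elim t by (auto simp: fun_eq_iff j_def cross2_def algebra_simps)
      ultimately show "(h has_derivative (\<lambda>r. 0)) (at t within {0..1})" by simp
    qed auto
    then show ?case by (simp add: h_def j_def)
  qed
  have d1: "((\<lambda>P'. u (P' + s *\<^sub>R rot (F P'))) has_derivative
      (\<lambda>v. F Q \<bullet> (v + s *\<^sub>R rot (A P v)) - cross2 Q (v + s *\<^sub>R rot (A P v)))) (at P)"
    unfolding Q_def f_def
    by (rule has_derivative_compose[OF _ du]) (auto intro!: derivative_eq_intros)
  have d2: "((\<lambda>P'. u P' - s * cross2 P' (rot (F P'))) has_derivative
      (\<lambda>v. F P \<bullet> v - cross2 P v - s * (cross2 P (rot (A P v)) + cross2 v (rot f)))) (at P)"
    by (auto intro!: derivative_eq_intros du simp: f_def)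
  have "((\<lambda>P'. u P' - s * cross2 P' (rot (F P'))) has_derivative
      (\<lambda>v. F Q \<bullet> (v + s *\<^sub>R rot (A P v)) - cross2 Q (v + s *\<^sub>R rot (A P v)))) (at P)"
    using ev' unfolding eventually_nhds_conv_at
    by (auto intro: has_derivative_transform_eventually[OF d1])
  \<comment> \<open>Two derivatives at \<open>P\<close> of the same function, compared in the
    direction \<open>f\<close> only; \<open>W\<close> records how the line turns when its starting
    point moves that way.\<close>
  from has_derivative_unique[OF this d2]
  have E: "F Q \<bullet> (f + s *\<^sub>R W) - cross2 Q (f + s *\<^sub>R W)
      = f \<bullet> f - cross2 P f - s * (cross2 P W + cross2 f (rot f))"
    unfolding W_def f_def by (rule fun_cong)
  have c1: "cross2 Q (f + s *\<^sub>R W) = cross2 P f + s * cross2 P W + s * (f \<bullet> f) + s\<^sup>2 * (f \<bullet> W)"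
    by (simp add: Q_def cross2_def rot_def inner_pair algebra_simps power2_eq_square)
  have c2: "cross2 f (rot f) = - (f \<bullet> f)"
    by (simp add: cross2_def rot_def inner_pair)
  have W: "f \<bullet> W = K P * (f \<bullet> f)"
    using K_eq'[OF f0] by (simp only: W_def f_def)
  have *: "F Q \<bullet> (f + s *\<^sub>R W) = (f \<bullet> f) * (1 + 2 * s + K P * s\<^sup>2)"
    using E unfolding c1 c2 W by (simp add: algebra_simps)
  have "F Q \<bullet> rot f = 0"
    using eventually_nhds_x_imp_x[OF ev] by (force simp: Q_def f_def dest: bspec[where x = 1])
  then have par: "F Q = ((F Q \<bullet> f) / (f \<bullet> f)) *\<^sub>R f"
    using f0 by (intro parallel_if_orthogonal_rot) (auto simp: f_def)
  define \<rho> where "\<rho> = (F Q \<bullet> f) / (f \<bullet> f)"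
  have ff: "f \<bullet> f \<noteq> 0" using f0 by (simp add: f_def)
  have "\<rho> * (1 + K P * s) * (f \<bullet> f) = (1 + 2 * s + K P * s\<^sup>2) * (f \<bullet> f)"
  proof -
    have "F Q \<bullet> (f + s *\<^sub>R W) = \<rho> * (f \<bullet> (f + s *\<^sub>R W))"
      by (subst par[folded \<rho>_def]) simp
    then show ?thesis using * W by (simp add: inner_add_right algebra_simps)
  qed
  then have "(1 + K P * s) * \<rho> = 1 + 2 * s + K P * s\<^sup>2"
    using ff by (simp add: mult.commute)
  then have "(1 + K P * s) *\<^sub>R F Q = (1 + 2 * s + K P * s\<^sup>2) *\<^sub>R f"
    by (subst par[folded \<rho>_def]) (simp only: scaleR_scaleR)
  then show ?thesis by (simp add: Q_def f_def)
qed

text \<open>Positivity at \<open>P\<close> alone suffices: by compactness of the parameter interval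
  it persists for all starting points near \<open>P\<close>, and there \<open>straight\<close>
  applies to every initial piece of the segment.\<close>

lemma line_formula_pos:
  assumes pos: "\<And>t. t \<in> {0..1} \<Longrightarrow> F (P + (t * s) *\<^sub>R rot (F P)) \<bullet> F P > 0"
  shows "(1 + K P * s) *\<^sub>R F (P + s *\<^sub>R rot (F P)) = (1 + 2 * s + K P * s\<^sup>2) *\<^sub>R F P"
proof (rule line_formula)
  show "F P \<noteq> 0" using pos[of 0] by auto
  define W where "W = {(P', t). F (P' + (t * s) *\<^sub>R rot (F P')) \<bullet> F P' > 0}"
  have "open W"
    unfolding W_def split_def by (intro open_Collect_less continuous_intros)
  moreover have "{P} \<times> {0..1} \<subseteq> W" using pos by (auto simp: W_def)
  ultimately obtain U where U: "P \<in> U" "open U" "U \<times> {0..1} \<subseteq> W"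
    using Elementary_Topology.tube_lemma[of "{0..1::real}" W P] by auto
  show "\<forall>\<^sub>F P' in nhds P. \<forall>t\<in>{0..1}. F (P' + (t * s) *\<^sub>R rot (F P')) \<bullet> rot (F P') = 0"
    unfolding eventually_nhds
  proof (intro exI[of _ U] conjI ballI)
    fix P' t assume "P' \<in> U" and t: "t \<in> {0..1::real}"
    show "F (P' + (t * s) *\<^sub>R rot (F P')) \<bullet> rot (F P') = 0"
    proof (rule straight)
      fix r :: real assume "r \<in> {0..1}"
      then have "r * t \<in> {0..1}" using t by (auto simp: mult_le_one)
      then have "(P', r * t) \<in> W" using U \<open>P' \<in> U\<close> by blast
      then show "F (P' + (r * (t * s)) *\<^sub>R rot (F P')) \<bullet> F P' > 0" by (simp add: W_def mult.assoc)
    qed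
  qed (use U in auto)
qed

text \<open>Continuation argument: up to the first parameter where positivity fails the formula
  holds, and in the limit it makes \<open>1 + 2 x + K x^2\<close> vanish there, against
  \<open>num\<close>.\<close>

lemma positive_along:
  assumes f0: "F P \<noteq> 0"
    and num: "\<And>t. t \<in> {0..1} \<Longrightarrow> 1 + 2 * (t * s) + K P * (t * s)\<^sup>2 > 0"
    and t: "t \<in> {0..1}"
  shows "F (P + (t * s) *\<^sub>R rot (F P)) \<bullet> F P > 0"
proof (rule ccontr)
  define X where "X = (\<lambda>t. P + (t * s) *\<^sub>R rot (F P))"
  define h where "h = (\<lambda>t. F (X t) \<bullet> F P)"
  have conth: "continuous_on S h" for S
    unfolding h_def X_def by (intro continuous_intros)
  define Z where "Z = {0..1} \<inter> {t. h t \<le> 0}"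
  assume "\<not> ?thesis"
  then have "Z \<noteq> {}" using t by (auto simp: Z_def h_def X_def)
  moreover have "compact Z"
    unfolding Z_def by (intro compact_Int_closed closed_Collect_le conth continuous_on_const) simp
  ultimately obtain z where z: "z \<in> Z" "\<And>t. t \<in> Z \<Longrightarrow> z \<le> t"
    using compact_attains_inf[of Z] by auto
  have "h 0 > 0" using f0 by (simp add: h_def X_def)
  then have z0: "z > 0" using z(1) by (cases "z = 0") (auto simp: Z_def)
  have z1: "z \<le> 1" "h z \<le> 0" using z(1) by (auto simp: Z_def)
  have hpos: "h t > 0" if "0 \<le> t" "t < z" for t
    using z(2)[of t] that z1 by (force simp: Z_def)
  have "(1 + K P * (z * s)) * h z - (1 + 2 * (z * s) + K P * (z * s)\<^sup>2) * (F P \<bullet> F P) = 0"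
  proof (rule constant_at_right_end[OF _ _ z0])
    show "continuous_on {0..z} (\<lambda>t. (1 + K P * (t * s)) * h t
        - (1 + 2 * (t * s) + K P * (t * s)\<^sup>2) * (F P \<bullet> F P))"
      by (intro continuous_intros conth)
    fix t assume t: "0 \<le> t" "t < z"
    have "(1 + K P * (t * s)) *\<^sub>R F (X t) = (1 + 2 * (t * s) + K P * (t * s)\<^sup>2) *\<^sub>R F P"
      unfolding X_def
    proof (rule line_formula_pos)
      fix r :: real assume r: "r \<in> {0..1}"
      have "r * t \<le> 1 * t" using r t by (intro mult_right_mono) auto
      then have "h (r * t) > 0" using r t by (intro hpos) auto
      then show "F (P + (r * (t * s)) *\<^sub>R rot (F P)) \<bullet> F P > 0"
        by (simp add: h_def X_def mult.assoc)
    qed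
    from arg_cong[OF this, of "\<lambda>v. v \<bullet> F P"]
    show "(1 + K P * (t * s)) * h t - (1 + 2 * (t * s) + K P * (t * s)\<^sup>2) * (F P \<bullet> F P) = 0"
      by (simp add: h_def)
  qed
  moreover have "h z = 0"
  proof -
    have "h z \<ge> 0"
      using continuous_ge_on_closure[of "{0..<z}" h z 0] hpos z0 conth by (force simp: less_imp_le)
    then show ?thesis using z1 by simp
  qed
  ultimately have "1 + 2 * (z * s) + K P * (z * s)\<^sup>2 = 0" using f0 by simp
  then show False using num[of z] z0 z1 by simp
qed

lemma formula_if_num_pos:
  assumes "F P \<noteq> 0" "\<And>t. t \<in> {0..1} \<Longrightarrow> 1 + 2 * (t * s) + K P * (t * s)\<^sup>2 > 0"
  shows "(1 + K P * s) *\<^sub>R F (P + s *\<^sub>R rot (F P)) = (1 + 2 * s + K P * s\<^sup>2) *\<^sub>R F P"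
  using positive_along[OF assms] by (rule line_formula_pos)

section \<open>Bounds for the curvature\<close>

text \<open>For negative \<open>K\<close> the pole \<open>s = - 1 / K\<close> lies on the positive
  side and the numerator stays positive up to it; at the pole the left side of the formula vanishes
  and the right side does not.\<close>

lemma K_nonneg: "F P \<noteq> 0 \<Longrightarrow> K P \<ge> 0"
proof (rule ccontr)
  assume f0: "F P \<noteq> 0" and "\<not> K P \<ge> 0"
  then have k: "K P < 0" by simp
  have "(1 + K P * (- 1 / K P)) *\<^sub>R F (P + (- 1 / K P) *\<^sub>R rot (F P))
    = (1 + 2 * (- 1 / K P) + K P * (- 1 / K P)\<^sup>2) *\<^sub>R F P"
  proof (rule formula_if_num_pos[OF f0])
    fix t :: real assume t: "t \<in> {0..1}"
    \<comment> \<open>At \<open>x = - t / K\<close> the numerator is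
      \<open>1 + t (t - 2) / K\<close>.\<close>
    have "t * (t - 2) / K P \<ge> 0"
      using t k by (intro divide_nonpos_neg mult_nonneg_nonpos) auto
    also have "t * (t - 2) / K P = 2 * (t * (- 1 / K P)) + K P * (t * (- 1 / K P))\<^sup>2"
      using k by (simp add: field_simps power2_eq_square)
    finally show "1 + 2 * (t * (- 1 / K P)) + K P * (t * (- 1 / K P))\<^sup>2 > 0" by simp
  qed
  then have "1 + 2 * (- 1 / K P) + K P * (- 1 / K P)\<^sup>2 = 0" using k f0 by simp
  then show False using k by (simp add: field_simps power2_eq_square)
qed

text \<open>For \<open>K > 1\<close> the numerator has no real zero, so again the formula reaches
  the pole.\<close>

lemma K_le_1: "F P \<noteq> 0 \<Longrightarrow> K P \<le> 1"
proof (rule ccontr)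
  assume f0: "F P \<noteq> 0" and "\<not> K P \<le> 1"
  then have k: "K P > 1" by simp
  have pos: "1 + 2 * x + K P * x\<^sup>2 > 0" for x
  proof -
    have "1 + 2 * x + K P * x\<^sup>2 = (1 + x)\<^sup>2 + (K P - 1) * x\<^sup>2"
      by (simp add: power2_eq_square algebra_simps)
    moreover have "(1 + x)\<^sup>2 + (K P - 1) * x\<^sup>2 > 0"
      using k by (cases "x = 0") (auto intro!: add_nonneg_pos)
    ultimately show ?thesis by simp
  qed
  have "(1 + K P * (- 1 / K P)) *\<^sub>R F (P + (- 1 / K P) *\<^sub>R rot (F P))
    = (1 + 2 * (- 1 / K P) + K P * (- 1 / K P)\<^sup>2) *\<^sub>R F P"
    by (rule formula_if_num_pos[OF f0 pos])
  then show False using pos[of "- 1 / K P"] k f0 by simp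
qed

text \<open>The two roots of \<open>1 + 2 x + K x\<^sup>2\<close> are \<open>- 1 / (1 \<plusminus> wd P)\<close>; the characteristic ray through \<open>P\<close>
  starts at the larger one.\<close>

definition wd :: "real \<times> real \<Rightarrow> real" where "wd P = sqrt (1 - K P)"

definition rad :: "real \<times> real \<Rightarrow> real" where "rad P = 1 / (1 + wd P)"

definition sing :: "real \<times> real \<Rightarrow> real \<times> real" where "sing P = P - rad P *\<^sub>R rot (F P)"

section \<open>Rays down to their singular end point\<close>

lemma wd_bounds: "F P \<noteq> 0 \<Longrightarrow> 0 \<le> wd P \<and> wd P \<le> 1"
  using K_nonneg[of P] K_le_1[of P] by (simp add: wd_def)

lemma K_wd: "F P \<noteq> 0 \<Longrightarrow> K P = 1 - (wd P)\<^sup>2"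
  using K_le_1[of P] by (simp add: wd_def)

lemma rad_bounds: "F P \<noteq> 0 \<Longrightarrow> 0 < rad P \<and> rad P \<le> 1"
  using wd_bounds[of P] by (simp add: rad_def)

lemma K_rad: "F P \<noteq> 0 \<Longrightarrow> K P * rad P = 1 - wd P"
proof -
  assume f0: "F P \<noteq> 0"
  have "1 - (wd P)\<^sup>2 = (1 - wd P) * (1 + wd P)" by (simp add: power2_eq_square algebra_simps)
  then show ?thesis using wd_bounds[OF f0] by (simp add: K_wd[OF f0] rad_def)
qed

text \<open>With \<open>w = wd P\<close> and \<open>K = 1 - w^2\<close> the quadratic splits into
  \<open>1 + (1 + w) x\<close> and \<open>1 + (1 - w) x\<close>. The first factor vanishes at
  \<open>- rad P\<close> and is at most the second one for negative \<open>x\<close>.\<close>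

lemma num_pos:
  assumes f0: "F P \<noteq> 0" and x: "x > - rad P"
  shows "1 + 2 * x + K P * x\<^sup>2 > 0"
proof -
  define w where "w = wd P"
  have w: "0 \<le> w" "w \<le> 1" using wd_bounds[OF f0] by (auto simp: w_def)
  have "- 1 < x * (1 + w)" using x w by (simp add: rad_def w_def[symmetric] field_simps)
  then have 1: "1 + (1 + w) * x > 0" by (simp add: algebra_simps)
  have 2: "1 + (1 - w) * x > 0"
  proof (cases "x \<ge> 0")
    case True then show ?thesis using w by (intro add_pos_nonneg) auto
  next
    case False
    then have "(1 + w) * x \<le> (1 - w) * x" using w by (intro mult_right_mono_neg) auto
    then show ?thesis using 1 by simp
  qed
  have "1 + 2 * x + K P * x\<^sup>2 = (1 + (1 + w) * x) * (1 + (1 - w) * x)"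
    by (simp add: K_wd[OF f0] w_def[symmetric] power2_eq_square algebra_simps)
  then show ?thesis using 1 2 by simp
qed

lemma scaled_gt_neg_rad:
  assumes f0: "F P \<noteq> 0" and x: "x > - rad P" and t: "t \<in> {0..1}"
  shows "t * x > - rad P"
proof (cases "x \<ge> 0")
  case True
  then have "t * x \<ge> 0" using t by simp
  then show ?thesis using rad_bounds[OF f0] by linarith
next
  case False
  then have "1 * x \<le> t * x" using t by (intro mult_right_mono_neg) auto
  then show ?thesis using x by simp
qed

lemma ray_pos:
  assumes f0: "F P \<noteq> 0" and x: "x > - rad P"
  shows "F (P + x *\<^sub>R rot (F P)) \<bullet> F P > 0"
  using positive_along[OF f0 num_pos[OF f0 scaled_gt_neg_rad[OF f0 x]], of 1] by simp

lemma ray_formula_open: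
  assumes f0: "F P \<noteq> 0" and x: "x > - rad P"
  shows "(1 + K P * x) *\<^sub>R F (P + x *\<^sub>R rot (F P)) = (1 + 2 * x + K P * x\<^sup>2) *\<^sub>R F P"
  using formula_if_num_pos[OF f0 num_pos[OF f0 scaled_gt_neg_rad[OF f0 x]]] .

lemma ray_formula:
  assumes f0: "F P \<noteq> 0" and x: "x \<ge> - rad P"
  shows "(1 + K P * x) *\<^sub>R F (P + x *\<^sub>R rot (F P)) = (1 + 2 * x + K P * x\<^sup>2) *\<^sub>R F P"
proof -
  have "(1 + K P * x) *\<^sub>R F (P + x *\<^sub>R rot (F P)) - (1 + 2 * x + K P * x\<^sup>2) *\<^sub>R F P = 0"
    by (rule constant_at_left_end[OF _ _ x])
       (auto intro!: continuous_intros simp: ray_formula_open[OF f0])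
  then show ?thesis by simp
qed

text \<open>Differentiating the ray formula in \<open>x\<close>; the limit at the end point of the
  ray will give the differential of \<open>F\<close> at that zero.\<close>

lemma ray_derivative_open:
  assumes f0: "F P \<noteq> 0" and x: "x > - rad P"
  shows "K P *\<^sub>R F (P + x *\<^sub>R rot (F P)) + (1 + K P * x) *\<^sub>R A (P + x *\<^sub>R rot (F P)) (rot (F P))
    = (2 + 2 * K P * x) *\<^sub>R F P"
proof -
  define j where "j = rot (F P)"
  have "((\<lambda>x. (1 + K P * x) *\<^sub>R F (P + x *\<^sub>R j)) has_vector_derivative
     ((1 + K P * x) *\<^sub>R A (P + x *\<^sub>R j) j + K P *\<^sub>R F (P + x *\<^sub>R j))) (at x)"
    by (rule has_vector_derivative_scaleR[OF _ F_line_has_vector_derivative])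
       (auto intro!: derivative_eq_intros)
  moreover have "((\<lambda>x. (1 + 2 * x + K P * x\<^sup>2) *\<^sub>R F P) has_vector_derivative
     ((1 + 2 * x + K P * x\<^sup>2) *\<^sub>R 0 + (2 + 2 * K P * x) *\<^sub>R F P)) (at x)"
    by (rule has_vector_derivative_scaleR) (auto intro!: derivative_eq_intros)
  then have "((\<lambda>x. (1 + K P * x) *\<^sub>R F (P + x *\<^sub>R j)) has_vector_derivative
     ((1 + 2 * x + K P * x\<^sup>2) *\<^sub>R 0 + (2 + 2 * K P * x) *\<^sub>R F P)) (at x)"
    by (rule has_vector_derivative_transform_within_open[where S = "{- rad P<..}"])
       (use x in \<open>auto simp: j_def ray_formula_open[OF f0]\<close>)
  ultimately have "(1 + K P * x) *\<^sub>R A (P + x *\<^sub>R j) j + K P *\<^sub>R F (P + x *\<^sub>R j)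
     = (1 + 2 * x + K P * x\<^sup>2) *\<^sub>R 0 + (2 + 2 * K P * x) *\<^sub>R F P"
    by (rule vector_derivative_unique_at)
  then show ?thesis by (simp add: j_def add.commute)
qed

lemma ray_derivative:
  assumes f0: "F P \<noteq> 0" and x: "x \<ge> - rad P"
  shows "K P *\<^sub>R F (P + x *\<^sub>R rot (F P)) + (1 + K P * x) *\<^sub>R A (P + x *\<^sub>R rot (F P)) (rot (F P))
    = (2 + 2 * K P * x) *\<^sub>R F P"
proof -
  have "K P *\<^sub>R F (P + x *\<^sub>R rot (F P)) + (1 + K P * x) *\<^sub>R A (P + x *\<^sub>R rot (F P)) (rot (F P))
    - (2 + 2 * K P * x) *\<^sub>R F P = 0"
    by (rule constant_at_left_end[OF _ _ x])
       (auto intro!: continuous_intros simp: ray_derivative_open[OF f0])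
  then show ?thesis by simp
qed

text \<open>For \<open>K = 1\<close> the numerator is \<open>(1 + x)^2\<close>, so both sides of the
  ray formula vanish at \<open>x = - 1\<close>. The common factor is therefore cancelled for
  \<open>x > - 1\<close> before passing to the limit.\<close>

lemma degenerate_ray:
  assumes f0: "F P \<noteq> 0" and k: "K P = 1" and x: "x \<ge> - 1"
  shows "F (P + x *\<^sub>R rot (F P)) = (1 + x) *\<^sub>R F P" "A (P + x *\<^sub>R rot (F P)) (rot (F P)) = F P"
proof -
  have r: "rad P = 1" by (simp add: rad_def wd_def k)
  have *: "F (P + x *\<^sub>R rot (F P)) = (1 + x) *\<^sub>R F P" if x: "x > - 1" for x
  proof -
    have "(1 + x) *\<^sub>R F (P + x *\<^sub>R rot (F P)) = (1 + x) *\<^sub>R ((1 + x) *\<^sub>R F P)"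
    proof -
      have "1 + 2 * x + x\<^sup>2 = (1 + x) * (1 + x)" by (simp add: power2_eq_square algebra_simps)
      then show ?thesis using ray_formula_open[OF f0, of x] x by (simp only: k r scaleR_scaleR) simp
    qed
    then show ?thesis using x by (simp only: scaleR_cancel_left) auto
  qed
  have "F (P + x *\<^sub>R rot (F P)) - (1 + x) *\<^sub>R F P = 0"
    by (rule constant_at_left_end[OF _ _ x]) (auto intro!: continuous_intros simp: *)
  then show "F (P + x *\<^sub>R rot (F P)) = (1 + x) *\<^sub>R F P" by simp
  show "A (P + x *\<^sub>R rot (F P)) (rot (F P)) = F P"
  proof (rule constant_at_left_end[OF _ _ x])
    fix x :: real assume x: "x > - 1"
    have "(1 + x) *\<^sub>R A (P + x *\<^sub>R rot (F P)) (rot (F P)) = (1 + x) *\<^sub>R F P"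
    proof -
      have "(1 + x) *\<^sub>R A (P + x *\<^sub>R rot (F P)) (rot (F P)) = (2 + 2 * x) *\<^sub>R F P - (1 + x) *\<^sub>R F P"
        using ray_derivative_open[OF f0, of x] x by (simp add: k r * eq_diff_eq add.commute)
      then show ?thesis unfolding scaleR_diff_left[symmetric] by simp
    qed
    then show "A (P + x *\<^sub>R rot (F P)) (rot (F P)) = F P"
      using x by (simp only: scaleR_cancel_left) auto
  qed (intro continuous_intros)
qed

lemma F_sing: assumes f0: "F P \<noteq> 0" shows "F (sing P) = 0"
proof (cases "wd P = 0")
  case True
  then have k: "K P = 1" "rad P = 1" using K_wd[OF f0] by (auto simp: rad_def)
  show ?thesis using degenerate_ray(1)[OF f0 k(1), of "- 1"] by (simp add: sing_def k(2))
next
  case False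
  \<comment> \<open>The numerator vanishes at \<open>- rad P\<close>, while the factor on the left
    of the ray formula equals \<open>wd P\<close>, here nonzero.\<close>
  have "1 + 2 * (- rad P) + K P * (- rad P)\<^sup>2 = 1 - 2 * rad P + (K P * rad P) * rad P"
    by (simp add: power2_eq_square)
  also have "\<dots> = 0"
    using wd_bounds[OF f0] unfolding K_rad[OF f0] by (simp add: rad_def field_simps)
  finally have "wd P *\<^sub>R F (sing P) = 0"
    using ray_formula[OF f0, of "- rad P"] K_rad[OF f0] by (simp add: sing_def)
  then show ?thesis using False by simp
qed

text \<open>At the end point the term with factor \<open>K P\<close> drops out because
  \<open>F\<close> vanishes. The remaining coefficients are \<open>wd P\<close> and
  \<open>2 * wd P\<close>, so for \<open>wd P > 0\<close> the result does not depend on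
  \<open>K\<close>; at a double root the factor 2 is lost.\<close>

lemma A_sing:
  assumes f0: "F P \<noteq> 0"
  shows "wd P > 0 \<Longrightarrow> A (sing P) (rot (F P)) = 2 *\<^sub>R F P"
    and "wd P = 0 \<Longrightarrow> A (sing P) (rot (F P)) = F P"
proof -
  assume w: "wd P > 0"
  have "1 + K P * (- rad P) = wd P" "2 + 2 * K P * (- rad P) = wd P * 2"
    using K_rad[OF f0] by (simp_all add: algebra_simps)
  then have "wd P *\<^sub>R A (sing P) (rot (F P)) = wd P *\<^sub>R (2 *\<^sub>R F P)"
    using ray_derivative[OF f0, of "- rad P"] F_sing[OF f0] K_rad[OF f0] by (simp add: sing_def)
  then show "A (sing P) (rot (F P)) = 2 *\<^sub>R F P" using w by (simp only: scaleR_cancel_left) auto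
next
  assume "wd P = 0"
  then have k: "K P = 1" "rad P = 1" using K_wd[OF f0] by (auto simp: rad_def)
  show "A (sing P) (rot (F P)) = F P"
    using degenerate_ray(2)[OF f0 k(1), of "- 1"] by (simp add: sing_def k(2))
qed

section \<open>Continuity of the ray data at regular points\<close>

lemma open_regular: "open {P. F P \<noteq> 0}"
  by (intro open_Collect_neq continuous_intros)

lemma isCont_K: "F P \<noteq> 0 \<Longrightarrow> isCont K P"
proof -
  have "continuous_on {P. F P \<noteq> 0} K"
    unfolding K_def by (intro continuous_intros) auto
  then show "F P \<noteq> 0 \<Longrightarrow> isCont K P"
    unfolding continuous_on_eq_continuous_at[OF open_regular] by blast
qed

lemma isCont_F: "isCont F P"
  using dF has_derivative_continuous by blast

lemma isCont_wd: "F P \<noteq> 0 \<Longrightarrow> isCont wd P"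
  unfolding wd_def by (intro continuous_intros isCont_K)

lemma isCont_rad: "F P \<noteq> 0 \<Longrightarrow> isCont rad P"
  unfolding rad_def using wd_bounds[of P] by (intro continuous_intros isCont_wd) auto

lemma isCont_sing: "F P \<noteq> 0 \<Longrightarrow> isCont sing P"
  unfolding sing_def by (intro continuous_intros isCont_rad isCont_F)

text \<open>Near a singular point this shows that a segment transversal to the zero curve contains
  at most one zero of \<open>F\<close>.\<close>

lemma transversally_increasing:
  assumes "\<And>Z. Z \<in> closed_segment Z1 (Z1 + c *\<^sub>R j) \<Longrightarrow> f \<bullet> A Z j > 0" "c > 0"
  shows "F Z1 \<bullet> f < F (Z1 + c *\<^sub>R j) \<bullet> f"
proof -
  define h where "h = (\<lambda>t. F (Z1 + (t * c) *\<^sub>R j) \<bullet> f)"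
  have "h 0 < h 1"
  proof (rule DERIV_pos_imp_increasing[of 0 1 h])
    fix t :: real assume t: "0 \<le> t" "t \<le> 1"
    have "Z1 + (t * c) *\<^sub>R j \<in> closed_segment Z1 (Z1 + c *\<^sub>R j)"
      using t unfolding closed_segment_def by (auto intro!: exI[of _ t] simp: algebra_simps)
    then have "c * (A (Z1 + (t * c) *\<^sub>R j) j \<bullet> f) > 0"
      using assms by (simp add: inner_commute)
    then show "\<exists>y. (h has_real_derivative y) (at t) \<and> y > 0"
      unfolding h_def using inner_F_line_has_derivative by blast
  qed simp
  then show ?thesis by (simp add: h_def)
qed

subsection \<open>Crossing the singular set\<close>

text \<open>The factor 2 in \<open>A_sing\<close> accounts for the whole curl, so
  \<open>A (sing P) (F P)\<close> has no component along \<open>rot (F P)\<close>: the differential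
  has rank one.\<close>

lemma range_A_sing:
  assumes f0: "F P \<noteq> 0" and w: "wd P > 0"
  shows "A (sing P) v \<bullet> rot (F P) = 0"
proof -
  have 1: "A (sing P) (rot (F P)) \<bullet> rot (F P) = 0" using A_sing(1)[OF f0 w] by simp
  have "F P \<bullet> A (sing P) (rot (F P)) - rot (F P) \<bullet> A (sing P) (F P) = 2 * cross2 (rot (F P)) (F P)"
    by (rule curl)
  moreover have "cross2 (rot (F P)) (F P) = F P \<bullet> F P" by (simp add: cross2_def rot_def inner_pair)
  ultimately have 2: "A (sing P) (F P) \<bullet> rot (F P) = 0"
    unfolding A_sing(1)[OF f0 w] by (simp add: inner_commute)
  show ?thesis
    by (subst orthogonal_decomp[OF f0, of v]) (simp add: A_add A_scaleR inner_add_left 1 2)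
qed

text \<open>The singular set near \<open>sing P\<close> is the curve \<open>sing (P + t F P)\<close>, and at each of its points the
  range of the differential determines the direction of the rays on both sides. A ray that ends
  just behind \<open>sing P\<close> therefore prolongs one of the rays through \<open>P + t F P\<close>, and since these
  do not meet near \<open>sing P\<close>, it prolongs the ray of \<open>P\<close> itself.\<close>

lemma crossing:
  assumes f0: "F P \<noteq> 0" and w0: "wd P > 0"
  shows "\<forall>\<^sub>F e in at_right 0. \<exists>c<0. F (P - (rad P + e) *\<^sub>R rot (F P)) = c *\<^sub>R F P"
proof -
  define f where "f = F P"
  define j where "j = rot f"
  define N where "N = f \<bullet> f"
  define r where "r = rad P"
  define k where "k = K P"
  define Q where "Q = sing P"
  define J where "J = (\<lambda>t. rot (F (P + t *\<^sub>R f)))"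
  define g where "g = (\<lambda>t. f \<bullet> J t)"
  have N: "N > 0" using f0 by (simp add: N_def f_def)
  have rk: "r * k < 1" using K_rad[OF f0] w0 by (simp add: r_def k_def mult.commute)
  \<comment> \<open>Half of \<open>1 - r * k = wd P\<close>. As \<open>k \<le> 1\<close>, going
    \<open>e0\<close> beyond \<open>Q\<close> keeps \<open>(r + e0) * k < 1\<close>, short of any
    focal point of the neighbouring lines.\<close>
  define e0 where "e0 = (1 - r * k) / 2"
  have e0_pos: "e0 > 0" using rk by (simp add: e0_def)
  have "e0 * k \<le> e0 * 1" using e0_pos K_le_1[OF f0] by (intro mult_left_mono) (auto simp: k_def)
  moreover have "r * k = 1 - 2 * e0" by (simp add: e0_def field_simps)
  ultimately have e0: "e0 > 0" "(r + e0) * k < 1" using e0_pos by (simp_all add: distrib_right)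
  have Q: "F Q = 0" "A Q j = 2 *\<^sub>R f" "Q = P - r *\<^sub>R j"
    using F_sing[OF f0] A_sing(1)[OF f0 w0] by (simp_all add: Q_def j_def f_def sing_def r_def)

  have "((\<lambda>t. F (P + t *\<^sub>R f)) has_vector_derivative A (P + 0 *\<^sub>R f) f) (at 0)"
    by (rule F_line_has_vector_derivative)
  then have "((\<lambda>t. F (P + t *\<^sub>R f)) has_derivative (\<lambda>t. t *\<^sub>R A P f)) (at 0)"
    by (simp add: has_vector_derivative_def)
  then have "(g has_derivative (\<lambda>t. f \<bullet> rot (t *\<^sub>R A P f))) (at 0)"
    unfolding g_def J_def by (intro derivative_intros)
  moreover have "f \<bullet> rot (t *\<^sub>R A P f) = k * N * t" for t
    using K_eq'[OF f0] by (simp add: rot_scaleR f_def k_def N_def)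
  ultimately have "(g has_real_derivative k * N) (at 0)"
    by (simp add: has_field_derivative_def)
  moreover have "g 0 = 0" by (simp add: g_def J_def f_def)
  \<comment> \<open>Caratheodory's form of the derivative: \<open>t\<close> splits off from
    \<open>g\<close> exactly, with a factor continuous at 0.\<close>
  ultimately obtain h where h: "\<And>t. g t = h t * t" "isCont h 0" "h 0 = k * N"
    unfolding CARAT_DERIV by auto

  \<comment> \<open>Near \<open>Q\<close> the \<open>f\<close> component of \<open>F\<close> grows
    strictly along \<open>j\<close>, because \<open>A Q j\<close> is twice \<open>f\<close>.\<close>
  define V where "V = {Z. f \<bullet> A Z j > 0}"
  have "open V" unfolding V_def by (intro open_Collect_less continuous_intros)
  moreover have "Q \<in> V" using N by (simp add: V_def Q(2) N_def)
  ultimately obtain d where d: "d > 0" "ball Q d \<subseteq> V" using open_contains_ball by blast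
  have incr: "F Z \<bullet> f < F (Z + c *\<^sub>R j) \<bullet> f"
    if "Z \<in> ball Q d" "Z + c *\<^sub>R j \<in> ball Q d" "c > 0" for Z c
  proof (rule transversally_increasing)
    fix Y assume "Y \<in> closed_segment Z (Z + c *\<^sub>R j)"
    then have "Y \<in> ball Q d" using that(1,2) closed_segment_subset[OF _ _ convex_ball] by blast
    then show "f \<bullet> A Y j > 0" using d by (auto simp: V_def)
  qed fact

  have cP: "isCont (\<lambda>t. P + t *\<^sub>R f) 0" by (intro continuous_intros)
  have cJ: "isCont J t" for t
    unfolding J_def by (intro continuous_intros isCont_o2[OF _ isCont_F])
  have cS: "isCont (\<lambda>t. sing (P + t *\<^sub>R f)) t" if "F (P + t *\<^sub>R f) \<noteq> 0" for t
    by (rule isCont_o2[where f = "\<lambda>t. P + t *\<^sub>R f" and g = sing, OF _ isCont_sing[OF that]]) (intro continuous_intros)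
  have "\<forall>\<^sub>F t in nhds 0. F (P + t *\<^sub>R f) \<noteq> 0"
  proof -
    have "open {t. F (P + t *\<^sub>R f) \<noteq> 0}" by (intro open_Collect_neq continuous_intros)
    then show ?thesis using f0 unfolding eventually_nhds by (intro exI[of _ "{t. F (P + t *\<^sub>R f) \<noteq> 0}"]) auto
  qed
  moreover have "\<forall>\<^sub>F t in nhds 0. wd (P + t *\<^sub>R f) > 0"
    by (rule isCont_eventually_pos, rule isCont_o2[OF cP]) (simp_all add: isCont_wd f0 w0)
  moreover have "\<forall>\<^sub>F t in nhds 0. N - rad (P + t *\<^sub>R f) * h t > 0"
  proof (rule isCont_eventually_pos)
    have "isCont (\<lambda>t. rad (P + t *\<^sub>R f)) 0" by (rule isCont_o2[OF cP]) (simp_all add: isCont_rad f0)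
    then show "isCont (\<lambda>t. N - rad (P + t *\<^sub>R f) * h t) 0" by (intro continuous_intros h)
    have "(r * k) * N < 1 * N" using rk N by (intro mult_strict_right_mono) auto
    then show "N - rad (P + 0 *\<^sub>R f) * h 0 > 0" by (simp add: h r_def[symmetric] mult.assoc)
  qed
  \<comment> \<open>At \<open>t = 0\<close> this is \<open>N * (1 - (r + e) * k)\<close>. Its
    positivity prevents the line through \<open>P + t f\<close> from passing through
    \<open>P - (r + e) j\<close> unless \<open>t = 0\<close>. It is taken for \<open>e0\<close> and
    0; the expression is affine in \<open>e\<close>, so values in between follow.\<close>
  moreover have ev: "\<forall>\<^sub>F t in nhds 0. J t \<bullet> j - (r + e) * h t > 0" if "(r + e) * k < 1" for e
  proof (rule isCont_eventually_pos)
    show "isCont (\<lambda>t. J t \<bullet> j - (r + e) * h t) 0" by (intro continuous_intros h cJ)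
    have "((r + e) * k) * N < 1 * N" using that N by (intro mult_strict_right_mono) auto
    then show "J 0 \<bullet> j - (r + e) * h 0 > 0"
      by (simp add: h J_def j_def f_def[symmetric] N_def[symmetric] mult.assoc)
  qed
  moreover have "\<forall>\<^sub>F t in nhds 0. sing (P + t *\<^sub>R f) \<in> ball Q d"
  proof -
    have "\<forall>\<^sub>F t in nhds 0. d - dist Q (sing (P + t *\<^sub>R f)) > 0"
    proof (rule isCont_eventually_pos)
      show "isCont (\<lambda>t. d - dist Q (sing (P + t *\<^sub>R f))) 0"
        using f0 by (intro continuous_intros cS) auto
    qed (use d in \<open>simp add: Q_def\<close>)
    then show ?thesis by simp
  qed
  ultimately have "\<forall>\<^sub>F t in nhds 0. F (P + t *\<^sub>R f) \<noteq> 0 \<and> wd (P + t *\<^sub>R f) > 0 \<and>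
      N - rad (P + t *\<^sub>R f) * h t > 0 \<and> J t \<bullet> j - (r + e0) * h t > 0 \<and> J t \<bullet> j - r * h t > 0 \<and>
      sing (P + t *\<^sub>R f) \<in> ball Q d"
    using ev[OF e0(2)] ev[of 0] rk by (simp add: eventually_conj_iff)
  then obtain t2 where t2: "t2 > 0" "\<And>t. \<bar>t\<bar> < t2 \<Longrightarrow> F (P + t *\<^sub>R f) \<noteq> 0 \<and> wd (P + t *\<^sub>R f) > 0 \<and>
      N - rad (P + t *\<^sub>R f) * h t > 0 \<and> J t \<bullet> j - (r + e0) * h t > 0 \<and> J t \<bullet> j - r * h t > 0 \<and>
      sing (P + t *\<^sub>R f) \<in> ball Q d"
    unfolding eventually_nhds_metric by (auto simp: dist_real_def)
  \<comment> \<open>Halved so that all conditions hold on a closed interval, on which the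
    intermediate value theorem is applied.\<close>
  define t1 where "t1 = t2 / 2"
  have t1: "t1 > 0" using t2 by (simp add: t1_def)
  have small: "F (P + t *\<^sub>R f) \<noteq> 0" "wd (P + t *\<^sub>R f) > 0" "N - rad (P + t *\<^sub>R f) * h t > 0"
     "J t \<bullet> j - (r + e0) * h t > 0" "J t \<bullet> j - r * h t > 0" "sing (P + t *\<^sub>R f) \<in> ball Q d"
     if "\<bar>t\<bar> \<le> t1" for t
    using t2(2)[of t] that t1 by (auto simp: t1_def)

  \<comment> \<open>Position along \<open>f\<close> of the end point of the ray through
    \<open>P + t f\<close>. It has the sign of \<open>t\<close> for small \<open>t\<close>, so these
    end points pass \<open>Q\<close> from one side to the other and attain every position near
    it.\<close>
  define \<tau> where "\<tau> = (\<lambda>t. (sing (P + t *\<^sub>R f) - P) \<bullet> f)"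
  have \<tau>: "\<tau> t = t * (N - rad (P + t *\<^sub>R f) * h t)" for t
  proof -
    have "\<tau> t = t * N - rad (P + t *\<^sub>R f) * g t"
      unfolding \<tau>_def
      by (subst inner_commute) (simp add: sing_def inner_diff_right inner_add_right J_def g_def N_def)
    then show ?thesis by (simp add: h algebra_simps)
  qed
  have "\<tau> (- t1) < 0" "\<tau> t1 > 0"
    using small(3)[of t1] small(3)[of "- t1"] t1 by (simp_all add: \<tau> mult_neg_pos)
  then have U0: "- \<tau> (- t1) > 0" "\<tau> t1 > 0" by auto
  define U where "U = {Z. (Z - P) \<bullet> f > \<tau> (- t1)} \<inter> {Z. (Z - P) \<bullet> f < \<tau> t1} \<inter> ball Q d"
  have "open U" unfolding U_def by (intro open_Int open_Collect_less continuous_intros open_ball)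
  moreover have "Q \<in> U" using U0 d by (simp add: U_def Q j_def)
  ultimately obtain d' where d': "d' > 0" "ball Q d' \<subseteq> U" using open_contains_ball by blast

  define Pe where "Pe = (\<lambda>e. P - (r + e) *\<^sub>R j)"
  have Pe: "Pe e = Q - e *\<^sub>R j" for e by (simp add: Pe_def Q algebra_simps)
  \<comment> \<open>As \<open>F\<close> vanishes at \<open>Q\<close>, both \<open>Pe e\<close> and
    the end point of its ray, at distance at most \<open>norm (F (Pe e))\<close> from it, tend to
    \<open>Q\<close> with \<open>e\<close>.\<close>
  have "\<forall>\<^sub>F e in nhds 0. d' - (norm (e *\<^sub>R j) + norm (F (Pe e))) > 0"
  proof (rule isCont_eventually_pos)
    show "isCont (\<lambda>e. d' - (norm (e *\<^sub>R j) + norm (F (Pe e)))) 0"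
      unfolding Pe_def by (intro continuous_intros isCont_o2[OF _ isCont_F])
  qed (use d' in \<open>simp add: Pe Q(1)\<close>)
  moreover have "\<forall>\<^sub>F e in nhds 0. d - norm (e *\<^sub>R j) > 0"
    by (rule isCont_eventually_pos) (use d in \<open>auto intro!: continuous_intros\<close>)
  moreover have "\<forall>\<^sub>F e in nhds 0. e0 - e > 0"
    by (rule isCont_eventually_pos) (use e0 in \<open>auto intro!: continuous_intros\<close>)
  ultimately have "\<forall>\<^sub>F e in nhds 0. d' - (norm (e *\<^sub>R j) + norm (F (Pe e))) > 0 \<and>
      d - norm (e *\<^sub>R j) > 0 \<and> e0 - e > 0" by eventually_elim auto
  then have "\<forall>\<^sub>F e in at_right 0. d' - (norm (e *\<^sub>R j) + norm (F (Pe e))) > 0 \<and>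
      d - norm (e *\<^sub>R j) > 0 \<and> e0 - e > 0"
    unfolding eventually_at_filter by (rule eventually_mono) auto
  then show ?thesis using eventually_at_right_less[of 0]
  proof eventually_elim
    case (elim e)
    have ball: "Pe e \<in> ball Q d" using elim by (simp add: Pe dist_norm)
    \<comment> \<open>Moving from \<open>Pe e\<close> by \<open>e\<close> along \<open>j\<close>
      leads to \<open>Q\<close>, a zero of \<open>F\<close>; so \<open>Pe e\<close> is regular and
      \<open>F\<close> has changed sides there.\<close>
    have "F (Pe e) \<bullet> f < F (Pe e + e *\<^sub>R j) \<bullet> f"
      using ball elim d by (intro incr) (auto simp: Pe)
    then have neg: "F (Pe e) \<bullet> f < 0" by (simp add: Pe Q(1))
    then have Fe: "F (Pe e) \<noteq> 0" by auto
    define S where "S = sing (Pe e)"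
    have "dist Q S \<le> norm (e *\<^sub>R j) + norm (F (Pe e))"
    proof -
      have "dist Q S = norm (e *\<^sub>R j + rad (Pe e) *\<^sub>R rot (F (Pe e)))"
        by (simp add: S_def sing_def Pe dist_norm algebra_simps)
      also have "\<dots> \<le> norm (e *\<^sub>R j) + norm (rad (Pe e) *\<^sub>R rot (F (Pe e)))" by (rule norm_triangle_ineq)
      also have "norm (rad (Pe e) *\<^sub>R rot (F (Pe e))) \<le> 1 * norm (F (Pe e))"
        using rad_bounds[OF Fe] by (simp add: mult_left_le_one_le)
      finally show ?thesis by simp
    qed
    then have "S \<in> U" using elim d' by auto
    then have S: "S \<in> ball Q d" "\<tau> (- t1) < (S - P) \<bullet> f" "(S - P) \<bullet> f < \<tau> t1" by (auto simp: U_def)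
    have "\<exists>t\<ge>- t1. t \<le> t1 \<and> \<tau> t = (S - P) \<bullet> f"
    proof (rule IVT')
      show "continuous_on {- t1..t1} \<tau>"
        unfolding \<tau>_def
        by (intro continuous_intros continuous_at_imp_continuous_on ballI cS small(1)) auto
    qed (use S t1 in auto)
    then obtain t where "- t1 \<le> t" "t \<le> t1" "\<tau> t = (S - P) \<bullet> f" by blast
    then have t: "\<bar>t\<bar> \<le> t1" "\<tau> t = (S - P) \<bullet> f" by auto
    define T where "T = sing (P + t *\<^sub>R f)"
    have T: "T \<in> ball Q d" "F T = 0" using small[OF t(1)] F_sing by (auto simp: T_def)
    have FS: "F S = 0" using F_sing[OF Fe] by (simp add: S_def)
    have "(S - T) \<bullet> f = 0" using t(2) by (simp add: \<tau>_def T_def inner_diff_left)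
    then have ST: "S = T + ((S - T) \<bullet> j / N) *\<^sub>R j"
      using orthogonal_decomp[of f "S - T"] f0 by (simp add: f_def[symmetric] j_def N_def algebra_simps)
    define c where "c = (S - T) \<bullet> j / N"
    have Sc: "S = T + c *\<^sub>R j" "T = S + (- c) *\<^sub>R j" using ST by (simp_all add: c_def algebra_simps)
    \<comment> \<open>\<open>S\<close> and \<open>T\<close> are zeros of \<open>F\<close> on one
      line in direction \<open>j\<close>, where the \<open>f\<close> component of \<open>F\<close>
      is strictly monotone.\<close>
    have "c = 0" using Sc incr[of T c] incr[of S "- c"] T S FS
      by (cases c "0::real" rule: linorder_cases) auto
    then have eq: "S = T" using Sc(1) by simp
    define Ft where "Ft = F (P + t *\<^sub>R f)"
    have Ft: "Ft \<noteq> 0" using small(1)[OF t(1)] by (simp add: Ft_def)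
    \<comment> \<open>In both cases of \<open>A_sing\<close>, \<open>F (Pe e)\<close> lies in the
      range of the differential at \<open>S\<close>; since \<open>S = T\<close>, that range consists
      of multiples of \<open>Ft\<close>.\<close>
    have "\<exists>b. F (Pe e) = A S (b *\<^sub>R rot (F (Pe e)))"
    proof (cases "wd (Pe e) = 0")
      case True
      then show ?thesis using A_sing(2)[OF Fe] by (intro exI[of _ 1]) (simp add: S_def)
    next
      case False
      then show ?thesis using A_sing(1)[OF Fe] wd_bounds[OF Fe]
        by (intro exI[of _ "1/2"]) (simp add: S_def A_scaleR)
    qed
    then have "F (Pe e) \<bullet> rot Ft = 0"
      using range_A_sing[of "P + t *\<^sub>R f"] small(1,2)[OF t(1)] unfolding Ft_def eq T_def by metis
    from parallel_if_orthogonal_rot[OF Ft this] obtain l where l: "F (Pe e) = l *\<^sub>R Ft" by blast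
    define m where "m = rad (Pe e) * l - rad (P + t *\<^sub>R f)"
    have Jt: "J t = rot Ft" by (simp add: J_def Ft_def)
    have "Pe e = S + rad (Pe e) *\<^sub>R rot (F (Pe e))" by (simp add: S_def sing_def)
    also have "\<dots> = P + t *\<^sub>R f + m *\<^sub>R J t"
      unfolding eq T_def sing_def m_def Jt l by (simp add: rot_scaleR algebra_simps Ft_def)
    finally have z: "t *\<^sub>R f + m *\<^sub>R J t + (r + e) *\<^sub>R j = 0" by (simp add: Pe_def algebra_simps)
    have z1: "t * N + m * (h t * t) = 0"
      using arg_cong[OF z, of "\<lambda>v. f \<bullet> v"] h(1)[of t]
      by (simp add: inner_add_right N_def j_def g_def)
    have z2: "m * (J t \<bullet> j) + (r + e) * N = 0"
      using arg_cong[OF z, of "\<lambda>v. v \<bullet> j"] by (simp add: inner_add_left N_def j_def)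
    \<comment> \<open>Eliminates \<open>m\<close> from the components of \<open>z\<close> along
      \<open>f\<close> and \<open>j\<close>.\<close>
    have "t * N * (J t \<bullet> j - (r + e) * h t)
        = (t * N + m * (h t * t)) * (J t \<bullet> j) - (m * (J t \<bullet> j) + (r + e) * N) * (h t * t)"
      by (simp add: algebra_simps)
    then have "t * N * (J t \<bullet> j - (r + e) * h t) = 0" unfolding z1 z2 by simp
    moreover have "J t \<bullet> j - (r + e) * h t > 0"
    proof (cases "h t \<ge> 0")
      case True
      then have "(r + e) * h t \<le> (r + e0) * h t" using elim by (intro mult_right_mono) auto
      then show ?thesis using small(4)[OF t(1)] by simp
    next
      case False
      then have "(r + e) * h t \<le> r * h t" using elim by (intro mult_right_mono_neg) auto
      then show ?thesis using small(5)[OF t(1)] by simp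
    qed
    ultimately have "t = 0" using N by simp
    then have lf: "F (Pe e) = l *\<^sub>R f" using l by (simp add: Ft_def f_def)
    then have "F (Pe e) \<bullet> f = l * N" by (simp add: N_def)
    then have "l < 0" using neg N by (simp add: mult_less_0_iff)
    then show ?case using lf by (intro exI[of _ l]) (simp add: Pe_def r_def j_def f_def)
  qed
qed

text \<open>Points behind \<open>sing P\<close> are reached from a regular point \<open>R\<close>
  between them and \<open>sing P\<close>. There \<open>F\<close> is a negative multiple of
  \<open>F P\<close>, so the ray of \<open>R\<close> runs outward along the same line.\<close>

lemma line_characteristic:
  assumes f0: "F P \<noteq> 0" and w0: "wd P > 0"
  shows "F (P + x *\<^sub>R rot (F P)) \<bullet> rot (F P) = 0"
proof -
  consider "x > - rad P" | "x = - rad P" | "x < - rad P" by linarith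
  then show ?thesis
  proof cases
    case 1
    show ?thesis
    proof (rule straight)
      fix t :: real assume "t \<in> {0..1}"
      then show "F (P + (t * x) *\<^sub>R rot (F P)) \<bullet> F P > 0"
        by (intro ray_pos f0 scaled_gt_neg_rad 1)
    qed
  next
    case 2
    then show ?thesis using F_sing[OF f0] by (simp add: sing_def)
  next
    case 3
    have "\<forall>\<^sub>F e in at_right 0. e < - rad P - x"
      using 3 unfolding eventually_at_right_field by (intro exI[of _ "- rad P - x"]) auto
    with crossing[OF f0 w0] have "\<forall>\<^sub>F e in at_right 0. e < - rad P - x \<and>
        (\<exists>c<0. F (P - (rad P + e) *\<^sub>R rot (F P)) = c *\<^sub>R F P)" by eventually_elim auto
    then obtain e c where e: "e < - rad P - x" "c < 0" "F (P - (rad P + e) *\<^sub>R rot (F P)) = c *\<^sub>R F P"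
      using eventually_happens'[OF trivial_limit_at_right_real] by blast
    define R where "R = P - (rad P + e) *\<^sub>R rot (F P)"
    have FR: "F R = c *\<^sub>R F P" using e by (simp add: R_def)
    have FR0: "F R \<noteq> 0" using FR f0 e by simp
    define y where "y = (x + rad P + e) / c"
    have y: "y > 0" using e by (simp add: y_def divide_neg_neg)
    have "y *\<^sub>R rot (F R) = (x + rad P + e) *\<^sub>R rot (F P)"
      using e(2) by (simp add: FR rot_scaleR y_def)
    then have X: "P + x *\<^sub>R rot (F P) = R + y *\<^sub>R rot (F R)"
      by (simp only:) (simp add: R_def algebra_simps)
    have "F (R + y *\<^sub>R rot (F R)) \<bullet> rot (F R) = 0"
    proof (rule straight)
      fix t :: real assume "t \<in> {0..1}"
      then show "F (R + (t * y) *\<^sub>R rot (F R)) \<bullet> F R > 0"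
        using y rad_bounds[OF FR0] by (intro ray_pos FR0 scaled_gt_neg_rad) auto
    qed
    then show ?thesis unfolding X using e(2) by (simp add: FR rot_scaleR)
  qed
qed

text \<open>\<open>wd P > 0\<close> is an open condition, so the entire lines through all points
  near \<open>P\<close> are characteristic and \<open>line_formula\<close> holds for every
  \<open>s\<close>.\<close>

lemma full_line_formula:
  assumes f0: "F P \<noteq> 0" and w0: "wd P > 0"
  shows "(1 + K P * s) *\<^sub>R F (P + s *\<^sub>R rot (F P)) = (1 + 2 * s + K P * s\<^sup>2) *\<^sub>R F P"
proof (rule line_formula[OF f0])
  have "\<forall>\<^sub>F P' in nhds P. F P' \<noteq> 0"
    using open_regular f0 unfolding eventually_nhds by (intro exI[of _ "{P. F P \<noteq> 0}"]) auto
  moreover have "\<forall>\<^sub>F P' in nhds P. wd P' > 0"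
    by (rule isCont_eventually_pos[OF isCont_wd[OF f0] w0])
  ultimately show "\<forall>\<^sub>F P' in nhds P. \<forall>t\<in>{0..1}. F (P' + (t * s) *\<^sub>R rot (F P')) \<bullet> rot (F P') = 0"
    by eventually_elim (auto intro: line_characteristic)
qed

text \<open>Strictly between 0 and 1 the formula also holds at the pole \<open>s = - 1 / K\<close>,
  where it would give \<open>1 - 1 / K = 0\<close>.\<close>

lemma K_dichotomy:
  assumes f0: "F P \<noteq> 0"
  shows "K P = 0 \<or> K P = 1"
proof (rule ccontr)
  assume *: "\<not> ?thesis"
  then have "wd P > 0" using wd_bounds[OF f0] K_wd[OF f0] by (cases "wd P = 0") auto
  from full_line_formula[OF f0 this, of "- 1 / K P"]
  have "1 + 2 * (- 1 / K P) + K P * (- 1 / K P)\<^sup>2 = 0" using * f0 by simp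
  then show False using * by (simp add: power2_eq_square field_simps)
qed

lemma full_line:
  assumes f0: "F P \<noteq> 0" and k: "K P = 0"
  shows "F (P + s *\<^sub>R rot (F P)) = (1 + 2 * s) *\<^sub>R F P"
  using full_line_formula[OF f0, of s] k by (simp add: wd_def)

subsection \<open>Global structure\<close>

text \<open>An identically vanishing \<open>F\<close> would have curl 0 instead of 2.\<close>

lemma regular_point_exists: obtains P where "F P \<noteq> 0"
proof -
  have False if "\<And>P. F P = 0"
  proof -
    have "F = (\<lambda>P. 0)" using that by auto
    then have "(F has_derivative (\<lambda>v. 0)) (at 0)" by simp
    then have "A 0 = (\<lambda>v. 0)" using dF has_derivative_unique by blast
    then show False using curl[of "(0, 1)" 0 "(1, 0)"] by (simp add: cross2_def)
  qed
  then show ?thesis using that by blast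
qed

lemma open_regular_K:
  assumes "open U"
  shows "open {P. F P \<noteq> 0 \<and> K P \<in> U}"
proof -
  have "continuous_on {P. F P \<noteq> 0} K"
    using continuous_on_eq_continuous_at[OF open_regular] isCont_K by blast
  from continuous_open_preimage[OF this open_regular assms]
  show ?thesis by (simp add: vimage_def Int_def)
qed

section \<open>The case of a point with \<open>K = 1\<close>: lines through a common centre\<close>

text \<open>Where \<open>K = 1\<close> the map gives the end point of the ray, as \<open>rad\<close>
  is 1. It is stationary along the ray. In direction \<open>F P\<close> its derivative is parallel
  to the ray and annihilated by the differential of \<open>F\<close> at the end point, which is
  injective on that direction.\<close>

lemma degenerate_center_locally_constant:
  assumes f0: "F P \<noteq> 0" and k: "K P = 1"
  shows "((\<lambda>P. P - rot (F P)) has_derivative (\<lambda>v. 0)) (at P)"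
proof -
  define f where "f = F P"
  define G where "G = (\<lambda>P. P - rot (F P))"
  define D where "D = (\<lambda>v. v - rot (A P v))"
  have DG: "(G has_derivative D) (at P)"
    unfolding G_def D_def by (auto intro!: derivative_eq_intros)
  have sing_G: "sing P' = G P'" if "F P' \<noteq> 0" "K P' = 1" for P'
    using that by (simp add: sing_def G_def rad_def wd_def)
  have "A P (rot f) = f"
    using degenerate_ray(2)[OF f0 k, of 0] by (simp add: f_def)
  then have D1: "D (rot f) = 0" by (simp add: D_def)
  have "D f \<bullet> f = 0"
    using K_eq'[OF f0] k by (simp add: D_def inner_diff_right f_def[symmetric] inner_commute)
  then have Df: "D f = ((D f \<bullet> rot f) / (f \<bullet> f)) *\<^sub>R rot f"
    using orthogonal_decomp[of f "D f"] f0 by (simp add: f_def)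
  \<comment> \<open>By the dichotomy \<open>K > 1/2\<close> means \<open>K = 1\<close>, so
    \<open>G\<close> maps all points near \<open>P\<close> to zeros of \<open>F\<close>.\<close>
  have "\<forall>\<^sub>F P' in at P. F (G P') = 0"
  proof -
    have "open {P'. F P' \<noteq> 0 \<and> K P' \<in> {1/2<..}}" by (rule open_regular_K) auto
    moreover have "F (G P') = 0" if "F P' \<noteq> 0" "K P' > 1/2" for P'
      using F_sing[OF that(1)] sing_G[OF that(1)] K_dichotomy[OF that(1)] that(2) by auto
    ultimately show ?thesis using f0 k unfolding eventually_at_topological
      by (intro exI[of _ "{P'. F P' \<noteq> 0 \<and> K P' \<in> {1/2<..}}"]) auto
  qed
  moreover have FG: "F (G P) = 0" using F_sing[OF f0] sing_G[OF f0 k] by simp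
  moreover have "((\<lambda>P. F (G P)) has_derivative (\<lambda>v. A (G P) (D v))) (at P)"
    using DG by (rule F_has_derivative)
  ultimately have "((\<lambda>P. 0) has_derivative (\<lambda>v. A (G P) (D v))) (at P)"
    using has_derivative_transform_eventually[of "\<lambda>P. F (G P)" _ P UNIV "\<lambda>P. 0"] by simp
  then have "A (G P) (D f) = 0" using has_derivative_zero_unique by (metis (no_types) has_derivative_const has_derivative_unique)
  moreover have "A (G P) (rot f) = f"
    using A_sing(2)[OF f0] sing_G[OF f0 k] k by (simp add: f_def wd_def)
  ultimately have "((D f \<bullet> rot f) / (f \<bullet> f)) *\<^sub>R f = 0" by (subst (asm) Df) (simp add: A_scaleR)
  then have D2: "D f = 0" using f0 by (subst Df) (simp add: f_def)
  have D: "D = (\<lambda>v. 0)"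
  proof
    fix v
    have lin: "linear D" using DG has_derivative_linear by blast
    show "D v = 0"
      using f0 by (subst orthogonal_decomp[of f v])
        (simp_all add: f_def[symmetric] linear_add[OF lin] linear_scale[OF lin] D1 D2)
  qed
  show ?thesis using DG unfolding D G_def .
qed

text \<open>Connectedness of the plane without \<open>Q\<close>: the degenerate points with centre
  \<open>Q\<close> form an open set, and so does the rest, because the dichotomy leaves a gap in the
  values of \<open>K\<close>.\<close>

lemma degenerate_global:
  assumes f0: "F P0 \<noteq> 0" and k: "K P0 = 1"
  obtains Q where "\<And>P. F P = - rot (P - Q)"
proof -
  define G where "G = (\<lambda>P. P - rot (F P))"
  have cG: "continuous_on UNIV G" unfolding G_def by (intro continuous_intros)
  define Q where "Q = G P0"
  define C1 where "C1 = {P. F P \<noteq> 0 \<and> K P \<in> {1/2<..}}"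
  define C where "C = {P \<in> C1. G P = Q}"
  define V where "V = {P. G P \<noteq> Q} \<union> {P. F P \<noteq> 0 \<and> K P \<in> {..<1/2}}"
  have C1: "open C1" unfolding C1_def by (rule open_regular_K) auto
  have K1: "F P \<noteq> 0 \<and> K P = 1" if "P \<in> C1" for P
    using that K_dichotomy[of P] by (auto simp: C1_def)
  have "open C"
    unfolding open_contains_ball
  proof
    fix P assume P: "P \<in> C"
    then have "P \<in> C1" by (simp add: C_def)
    from openE[OF C1 this] obtain d where d: "d > 0" "ball P d \<subseteq> C1" .
    have const: "G P' = G P" if "P' \<in> ball P d" for P'
    proof (rule has_derivative_zero_unique[of "ball P d" G])
      fix Z assume "Z \<in> ball P d"
      then have "F Z \<noteq> 0 \<and> K Z = 1" using d(2) K1 by blast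
      then show "(G has_derivative (\<lambda>v. 0)) (at Z within ball P d)"
        unfolding G_def
        by (intro has_derivative_at_withinI[OF degenerate_center_locally_constant]) simp_all
    qed (use d that in auto)
    have "ball P d \<subseteq> C"
    proof
      fix Z assume Z: "Z \<in> ball P d"
      then show "Z \<in> C" using const[OF Z] d(2) P by (auto simp: C_def)
    qed
    then show "\<exists>e>0. ball P e \<subseteq> C" using d(1) by blast
  qed
  moreover have "open V"
    unfolding V_def by (intro open_Un open_regular_K open_Collect_neq cG continuous_on_const) auto
  moreover have "connected (- {Q})"
    by (intro path_connected_imp_connected path_connected_punctured_universe) simp
  moreover have "C \<inter> V \<inter> - {Q} = {}" by (auto simp: C_def V_def C1_def)
  moreover have "- {Q} \<subseteq> C \<union> V"
  proof
    fix P assume "P \<in> - {Q}"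
    show "P \<in> C \<union> V"
    proof (cases "G P = Q")
      case True
      \<comment> \<open>\<open>G P = Q\<close> together with \<open>F P = 0\<close> would mean
        \<open>P = Q\<close>, the removed point.\<close>
      then have "F P \<noteq> 0" using \<open>P \<in> - {Q}\<close> by (auto simp: G_def)
      then show ?thesis using True K_dichotomy[of P] by (auto simp: C_def V_def C1_def)
    qed (simp add: V_def)
  qed
  ultimately have "C \<inter> - {Q} = {} \<or> V \<inter> - {Q} = {}" by (intro connectedD) auto
  moreover have "P0 \<in> C \<inter> - {Q}" using f0 k by (auto simp: C_def C1_def Q_def G_def)
  ultimately have sub: "- {Q} \<subseteq> C" using \<open>- {Q} \<subseteq> C \<union> V\<close> by blast
  have "F P = - rot (P - Q)" for P
  proof (cases "P = Q")
    case True
    have "sing P0 = Q" using k by (simp add: Q_def G_def sing_def rad_def wd_def)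
    then have "F Q = 0" using F_sing[OF f0] by simp
    then show ?thesis using True by simp
  next
    case False
    then have "G P = Q" using sub by (auto simp: C_def)
    then have "P - Q = rot (F P)" by (simp add: G_def algebra_simps)
    then show ?thesis by simp
  qed
  then show ?thesis using that by blast
qed

text \<open>The linear part of \<open>F\<close> cancels the \<open>cross2\<close> term in the
  differential of \<open>u\<close>, which leaves the constant gradient \<open>rot Q\<close>.\<close>

lemma degenerate_affine:
  assumes "\<And>P. F P = - rot (P - Q)"
  shows "\<exists>a b c. \<forall>x y. u (x, y) = a * x + b * y + c"
proof -
  have affine: "u P - rot Q \<bullet> P = u 0 - rot Q \<bullet> 0" for P
  proof (rule has_derivative_zero_unique[of UNIV "\<lambda>P. u P - rot Q \<bullet> P"])
    fix Z
    have "((\<lambda>P. u P - rot Q \<bullet> P) has_derivative (\<lambda>v. F Z \<bullet> v - cross2 Z v - rot Q \<bullet> v)) (at Z)"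
      by (auto intro!: derivative_eq_intros du)
    moreover have "F Z \<bullet> v - cross2 Z v - rot Q \<bullet> v = 0" for v
      by (simp add: assms rot_def inner_pair cross2_def algebra_simps)
    ultimately show "((\<lambda>P. u P - rot Q \<bullet> P) has_derivative (\<lambda>v. 0)) (at Z within UNIV)" by simp
  qed auto
  have "u (x, y) = fst (rot Q) * x + snd (rot Q) * y + u 0" for x y
    using affine[of "(x, y)"] by (simp add: inner_pair)
  then show ?thesis by blast
qed

section \<open>The case \<open>K = 0\<close> at all regular points: parallel lines\<close>

text \<open>With \<open>K = 0\<close>, \<open>eqn\<close> makes every derivative of \<open>F\<close>
  parallel to \<open>F\<close>, so \<open>F\<close> changes in length only; \<open>b / a\<close>
  measures its angle to \<open>F R\<close>.\<close>

lemma direction_locally_constant: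
  assumes k: "\<And>P. F P \<noteq> 0 \<Longrightarrow> K P = 0" and f0: "F R \<noteq> 0"
  shows "\<forall>\<^sub>F Z in nhds R. F Z \<noteq> 0 \<and> F Z \<bullet> rot (F R) = 0"
proof -
  define f where "f = F R"
  define j where "j = rot f"
  define a where "a = (\<lambda>Z. F Z \<bullet> f)"
  define b where "b = (\<lambda>Z. F Z \<bullet> j)"
  have ff: "f \<bullet> f \<noteq> 0" using f0 by (simp add: f_def)
  have "open {Z. a Z > 0}" unfolding a_def by (intro open_Collect_less continuous_intros)
  moreover have "a R > 0" using f0 by (simp add: a_def f_def)
  ultimately obtain d where d: "d > 0" "ball R d \<subseteq> {Z. a Z > 0}"
    unfolding open_contains_ball by blast
  have const: "b Z / a Z = b R / a R" if "Z \<in> ball R d" for Z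
  proof (rule has_derivative_zero_unique[of "ball R d" "\<lambda>Z. b Z / a Z"])
    fix Y assume "Y \<in> ball R d"
    then have aY: "a Y > 0" using d by auto
    then have FY: "F Y \<noteq> 0" by (auto simp: a_def)
    have A0: "A Y v \<bullet> rot (F Y) = 0" for v
      using K_eq[OF FY] k[OF FY] eqn[of Y]
      by (subst orthogonal_decomp[OF FY, of v]) (simp add: A_add A_scaleR inner_add_right inner_commute)
    have "(f \<bullet> f) *\<^sub>R F Y = (f \<bullet> f) *\<^sub>R ((a Y / (f \<bullet> f)) *\<^sub>R f + (b Y / (f \<bullet> f)) *\<^sub>R j)"
      using orthogonal_decomp[of f "F Y"] f0 by (simp add: f_def[symmetric] a_def b_def j_def)
    then have "(f \<bullet> f) *\<^sub>R F Y = a Y *\<^sub>R f + b Y *\<^sub>R j" using ff by (simp add: scaleR_add_right)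
    then have "rot ((f \<bullet> f) *\<^sub>R F Y) = a Y *\<^sub>R j - b Y *\<^sub>R f" by (simp add: rot_add rot_scaleR j_def)
    then have r: "(f \<bullet> f) *\<^sub>R rot (F Y) = a Y *\<^sub>R j - b Y *\<^sub>R f" by (simp add: rot_scaleR)
    have ab: "a Y * (A Y v \<bullet> j) = b Y * (A Y v \<bullet> f)" for v
    proof -
      have "A Y v \<bullet> ((f \<bullet> f) *\<^sub>R rot (F Y)) = 0" using A0[of v] by simp
      then show ?thesis unfolding r by (simp add: inner_diff_right)
    qed
    have "((\<lambda>Z. b Z / a Z) has_derivative
       (\<lambda>v. - b Y * (inverse (a Y) * (A Y v \<bullet> f) * inverse (a Y)) + (A Y v \<bullet> j) / a Y)) (at Y within ball R d)"
    proof (rule has_derivative_divide)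
      show "(b has_derivative (\<lambda>v. A Y v \<bullet> j)) (at Y within ball R d)"
        "(a has_derivative (\<lambda>v. A Y v \<bullet> f)) (at Y within ball R d)"
        unfolding a_def b_def by (auto intro!: derivative_eq_intros)
    qed (use aY in auto)
    moreover have "- b Y * (inverse (a Y) * (A Y v \<bullet> f) * inverse (a Y)) + (A Y v \<bullet> j) / a Y = 0" for v
      using ab[of v] aY by (simp add: field_simps)
    ultimately show "((\<lambda>Z. b Z / a Z) has_derivative (\<lambda>v. 0)) (at Y within ball R d)" by simp
  qed (use d that in auto)
  have bR: "b R = 0" by (simp add: b_def j_def f_def)
  have "F Z \<noteq> 0 \<and> F Z \<bullet> rot (F R) = 0" if Z: "Z \<in> ball R d" for Z
  proof -
    have "a Z > 0" using Z d by auto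
    moreover from this have "b Z = 0" using const[OF Z] bR by simp
    ultimately show ?thesis by (auto simp: a_def b_def j_def f_def)
  qed
  then show ?thesis unfolding eventually_nhds using d(1)
    by (intro exI[of _ "ball R d"]) auto
qed

text \<open>Zeros of \<open>F\<close> may separate the regular points, so local constancy of the
  direction is not enough. Instead whole lines in direction \<open>j\<close> are followed:
  \<open>T\<close> collects the positions of the characteristic ones. Each of them carries a regular
  point, from which the neighbouring lines are reached.\<close>

lemma nondegenerate_global:
  assumes k: "\<And>P. F P \<noteq> 0 \<Longrightarrow> K P = 0" and f0: "F P0 \<noteq> 0"
  shows "F Z \<bullet> rot (F P0) = 0"
proof -
  define f where "f = F P0"
  define j where "j = rot f"
  have f0': "f \<noteq> 0" using f0 by (simp add: f_def)
  define T where "T = {t. F (P0 + t *\<^sub>R f) \<bullet> j = 0 \<and>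
    (\<forall>s. F (P0 + t *\<^sub>R f + s *\<^sub>R j) = F (P0 + t *\<^sub>R f) + (2 * s) *\<^sub>R f)}"
  have "closed T"
    unfolding T_def
    by (intro closed_Collect_conj closed_Collect_all closed_Collect_eq continuous_intros)
  moreover have "open T"
    unfolding open_subopen[of T]
  proof
    fix t assume t: "t \<in> T"
    define c where "c = (F (P0 + t *\<^sub>R f) \<bullet> f) / (f \<bullet> f)"
    \<comment> \<open>Chosen so that \<open>F R = f\<close>, a regular point on the line with
      exactly the reference direction.\<close>
    define s where "s = (1 - c) / 2"
    define R where "R = P0 + t *\<^sub>R f + s *\<^sub>R j"
    have "F (P0 + t *\<^sub>R f) = c *\<^sub>R f"
      using t parallel_if_orthogonal_rot[OF f0'] by (simp add: T_def j_def c_def)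
    then have "F R = c *\<^sub>R f + (2 * s) *\<^sub>R f" using t by (simp add: T_def R_def)
    also have "\<dots> = (c + 2 * s) *\<^sub>R f" by (simp only: scaleR_add_left)
    also have "c + 2 * s = 1" by (simp add: s_def field_simps)
    also have "1 *\<^sub>R f = f" by simp
    finally have FR: "F R = f" .
    obtain S where S: "open S" "R \<in> S" "\<And>Z. Z \<in> S \<Longrightarrow> F Z \<noteq> 0 \<and> F Z \<bullet> j = 0"
      using direction_locally_constant[OF k, of R] f0' unfolding FR eventually_nhds j_def by blast
    define S' where "S' = (\<lambda>t. P0 + t *\<^sub>R f + s *\<^sub>R j) -` S"
    have "open S'" unfolding S'_def by (intro open_vimage S continuous_intros)
    moreover have "t \<in> S'" using S by (simp add: S'_def R_def)
    moreover have "S' \<subseteq> T"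
    proof
      fix t' assume "t' \<in> S'"
      define Z where "Z = P0 + t' *\<^sub>R f + s *\<^sub>R j"
      have Z: "F Z \<noteq> 0" "F Z \<bullet> j = 0" using \<open>t' \<in> S'\<close> S(3) by (auto simp: S'_def Z_def)
      define d where "d = (F Z \<bullet> f) / (f \<bullet> f)"
      have FZ: "F Z = d *\<^sub>R f" using parallel_if_orthogonal_rot[OF f0', of "F Z"] Z by (simp add: d_def j_def)
      have d: "d \<noteq> 0" using FZ Z by auto
      \<comment> \<open>\<open>full_line\<close> is based at \<open>Z\<close>, where
        \<open>rot (F Z)\<close> is \<open>d\<close> times \<open>j\<close>; hence the parameter
        \<open>(y - s) / d\<close>.\<close>
      have *: "F (P0 + t' *\<^sub>R f + y *\<^sub>R j) = (d + 2 * (y - s)) *\<^sub>R f" for y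
      proof -
        have "((y - s) / d) *\<^sub>R rot (F Z) = (y - s) *\<^sub>R j"
          using d by (simp add: FZ rot_scaleR j_def)
        then have "P0 + t' *\<^sub>R f + y *\<^sub>R j = Z + ((y - s) / d) *\<^sub>R rot (F Z)"
          by (simp only:) (simp add: Z_def algebra_simps)
        also have "F \<dots> = (1 + 2 * ((y - s) / d)) *\<^sub>R F Z" using Z k by (intro full_line) auto
        also have "\<dots> = (d + 2 * (y - s)) *\<^sub>R f" using d by (simp add: FZ distrib_right)
        finally show ?thesis .
      qed
      have F0: "F (P0 + t' *\<^sub>R f) = (d + 2 * (0 - s)) *\<^sub>R f" using *[of 0] by simp
      show "t' \<in> T" unfolding T_def
      proof (intro CollectI conjI allI)
        show "F (P0 + t' *\<^sub>R f) \<bullet> j = 0" by (simp add: F0 j_def)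
        show "F (P0 + t' *\<^sub>R f + y *\<^sub>R j) = F (P0 + t' *\<^sub>R f) + (2 * y) *\<^sub>R f" for y
          unfolding * F0 scaleR_add_left[symmetric] by simp
      qed
    qed
    ultimately show "\<exists>S. open S \<and> t \<in> S \<and> S \<subseteq> T" by blast
  qed
  moreover have "0 \<in> T"
    using full_line[OF f0 k[OF f0]] by (simp add: T_def f_def[symmetric] j_def scaleR_add_left)
  ultimately have T: "T = UNIV" using clopen[of T] by auto
  define t where "t = ((Z - P0) \<bullet> f) / (f \<bullet> f)"
  define s where "s = ((Z - P0) \<bullet> j) / (f \<bullet> f)"
  have "Z - P0 = t *\<^sub>R f + s *\<^sub>R j"
    unfolding t_def s_def j_def by (rule orthogonal_decomp[OF f0'])
  then have Z: "Z = P0 + t *\<^sub>R f + s *\<^sub>R j" by (simp add: algebra_simps)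
  have "t \<in> T" using T by simp
  then show ?thesis
    unfolding Z by (simp add: T_def inner_add_left j_def f_def)
qed

text \<open>In the orthonormal coordinates \<open>v = a x + b y\<close> and
  \<open>w = - b x + a y\<close> the quadratic part is the product \<open>v * w\<close>. Along a
  line of constant \<open>w\<close> the \<open>F\<close> term vanishes and the \<open>cross2\<close>
  term gives \<open>u\<close> the slope \<open>w\<close>; \<open>g\<close> is the restriction of
  \<open>u\<close> to \<open>v = 0\<close>.\<close>

lemma parallel_lines_form:
  assumes ab: "a\<^sup>2 + b\<^sup>2 = 1" and e: "\<And>Z. F Z \<bullet> (a, b) = 0"
  shows "\<exists>g. C2_line g \<and> (\<forall>x y. u (x, y) = - a * b * x\<^sup>2 + (a\<^sup>2 - b\<^sup>2) * x * y + a * b * y\<^sup>2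
    + g (- b * x + a * y))"
proof -
  define n where "n = (- b, a)"
  define g where "g = (\<lambda>w. u (w *\<^sub>R n))"
  have line: "((\<lambda>w. F (0 + (w * 1) *\<^sub>R n) \<bullet> n) has_real_derivative 1 * (A (0 + (w * 1) *\<^sub>R n) n \<bullet> n)) (at w)" for w
    by (rule inner_F_line_has_derivative)
  have g': "(g has_real_derivative F (w *\<^sub>R n) \<bullet> n) (at w)" for w
  proof -
    have "(g has_derivative (\<lambda>h. F (w *\<^sub>R n) \<bullet> (h *\<^sub>R n) - cross2 (w *\<^sub>R n) (h *\<^sub>R n))) (at w)"
      unfolding g_def by (rule has_derivative_compose[OF _ du]) (auto intro!: derivative_eq_intros)
    moreover have "F (w *\<^sub>R n) \<bullet> (h *\<^sub>R n) - cross2 (w *\<^sub>R n) (h *\<^sub>R n) = (F (w *\<^sub>R n) \<bullet> n) * h" for h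
      by (simp add: cross2_def)
    ultimately show ?thesis by (simp add: has_field_derivative_def mult_commute_abs)
  qed
  have dg: "deriv g = (\<lambda>w. F (w *\<^sub>R n) \<bullet> n)" using g' DERIV_imp_deriv by blast
  have g'': "(deriv g has_real_derivative A (w *\<^sub>R n) n \<bullet> n) (at w)" for w
    using line[of w] by (simp add: dg)
  have ddg: "deriv (deriv g) = (\<lambda>w. A (w *\<^sub>R n) n \<bullet> n)" using g'' DERIV_imp_deriv by blast
  have "C2_line g"
    unfolding C2_line_def ddg real_differentiable_def
    by (intro conjI continuous_intros) (use g' g'' in blast)+
  moreover have "u (x, y) = - a * b * x\<^sup>2 + (a\<^sup>2 - b\<^sup>2) * x * y + a * b * y\<^sup>2 + g (- b * x + a * y)" for x y
  proof -
    define v where "v = a * x + b * y"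
    define w where "w = - b * x + a * y"
    define h where "h = (\<lambda>t. u (w *\<^sub>R n + t *\<^sub>R (a, b)) - t * w)"
    have "h v = h 0"
    proof (rule has_derivative_zero_unique[of UNIV h])
      fix t
      define Z where "Z = w *\<^sub>R n + t *\<^sub>R (a, b)"
      have "((\<lambda>t. u (w *\<^sub>R n + t *\<^sub>R (a, b))) has_derivative
          (\<lambda>r. F Z \<bullet> (r *\<^sub>R (a, b)) - cross2 Z (r *\<^sub>R (a, b)))) (at t)"
        unfolding Z_def by (rule has_derivative_compose[OF _ du]) (auto intro!: derivative_eq_intros)
      then have "(h has_derivative (\<lambda>r. F Z \<bullet> (r *\<^sub>R (a, b)) - cross2 Z (r *\<^sub>R (a, b)) - r * w)) (at t)"
        unfolding h_def by (auto intro!: derivative_eq_intros)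
      moreover have "F Z \<bullet> (r *\<^sub>R (a, b)) - cross2 Z (r *\<^sub>R (a, b)) - r * w = 0" for r
      proof -
        have "cross2 Z (r *\<^sub>R (a, b)) = - (r * w) * (a\<^sup>2 + b\<^sup>2)"
          by (simp add: cross2_def Z_def n_def power2_eq_square algebra_simps)
        moreover have "F Z \<bullet> (r *\<^sub>R (a, b)) = 0" using e[of Z] by (simp only: inner_scaleR_right)
        ultimately show ?thesis using ab by simp
      qed
      ultimately show "(h has_derivative (\<lambda>r. 0)) (at t within UNIV)" by simp
    qed auto
    moreover have "w *\<^sub>R n + v *\<^sub>R (a, b) = (x, y)"
    proof -
      have "w *\<^sub>R n + v *\<^sub>R (a, b) = ((a\<^sup>2 + b\<^sup>2) * x, (a\<^sup>2 + b\<^sup>2) * y)"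
        by (simp add: n_def v_def w_def power2_eq_square algebra_simps)
      then show ?thesis using ab by simp
    qed
    ultimately have "u (x, y) = g w + v * w"
      by (simp add: h_def g_def zero_prod_def[symmetric])
    then show ?thesis by (simp add: v_def w_def power2_eq_square algebra_simps)
  qed
  ultimately show ?thesis by blast
qed

lemma classification:
  "(\<exists>a b c. \<forall>x y. u (x, y) = a * x + b * y + c) \<or>
   (\<exists>a b g. a\<^sup>2 + b\<^sup>2 = 1 \<and> C2_line g \<and>
     (\<forall>x y. u (x, y) = - a * b * x\<^sup>2 + (a\<^sup>2 - b\<^sup>2) * x * y + a * b * y\<^sup>2 + g (- b * x + a * y)))"
proof (cases "\<exists>P. F P \<noteq> 0 \<and> K P = 1")
  case True
  then show ?thesis using degenerate_global degenerate_affine by metis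
next
  case False
  then have k: "F P \<noteq> 0 \<Longrightarrow> K P = 0" for P using K_dichotomy by blast
  obtain P0 where P0: "F P0 \<noteq> 0" using regular_point_exists by blast
  define j where "j = rot (F P0)"
  define a where "a = fst j / norm j"
  define b where "b = snd j / norm j"
  have nj: "norm j \<noteq> 0" using P0 by (simp add: j_def)
  have sq: "(fst j)\<^sup>2 + (snd j)\<^sup>2 = (norm j)\<^sup>2" by (simp add: norm_prod_def)
  have "a\<^sup>2 + b\<^sup>2 = ((fst j)\<^sup>2 + (snd j)\<^sup>2) / (norm j)\<^sup>2"
    by (simp add: a_def b_def power_divide add_divide_distrib)
  also have "\<dots> = 1" unfolding sq using nj by simp
  finally have "a\<^sup>2 + b\<^sup>2 = 1" .
  moreover have "F Z \<bullet> (a, b) = 0" for Z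
  proof -
    have "(a, b) = (1 / norm j) *\<^sub>R j" by (simp add: a_def b_def prod_eq_iff)
    then show ?thesis using nondegenerate_global[OF k P0, of Z] by (simp add: j_def)
  qed
  ultimately show ?thesis using parallel_lines_form by blast
qed

end

subsection \<open>Functions of class \<open>C\<^sup>2\<close> on the plane\<close>

lemma C1_plane_has_derivative:
  assumes "C1_plane f"
  shows "(f has_derivative (\<lambda>v. px f P * fst v + py f P * snd v)) (at P)"
proof -
  obtain x y where P: "P = (x, y)" by (cases P)
  obtain D where D: "(f has_derivative D) (at (x, y))"
    using assms unfolding C1_plane_def differentiable_def P by blast
  have lin: "linear D" using D has_derivative_linear by blast
  have "((\<lambda>s. f (s, y)) has_derivative (\<lambda>h. D (h, 0))) (at x)"
    by (rule has_derivative_compose[where f = "\<lambda>s. (s, y)", OF _ D]) (auto intro!: derivative_eq_intros)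
  moreover have "(\<lambda>h. D (h, 0)) = (*) (D (1, 0))"
  proof
    show "D (h, 0) = D (1, 0) * h" for h using linear_scale[OF lin, of h "(1, 0)"] by simp
  qed
  ultimately have "((\<lambda>s. f (s, y)) has_real_derivative D (1, 0)) (at x)"
    by (simp only: has_field_derivative_def)
  then have 1: "px f P = D (1, 0)" unfolding px_def P by (simp add: DERIV_imp_deriv)
  have "((\<lambda>t. f (x, t)) has_derivative (\<lambda>h. D (0, h))) (at y)"
    by (rule has_derivative_compose[where f = "\<lambda>t. (x, t)", OF _ D]) (auto intro!: derivative_eq_intros)
  moreover have "(\<lambda>h. D (0, h)) = (*) (D (0, 1))"
  proof
    show "D (0, h) = D (0, 1) * h" for h using linear_scale[OF lin, of h "(0, 1)"] by simp
  qed
  ultimately have "((\<lambda>t. f (x, t)) has_real_derivative D (0, 1)) (at y)"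
    by (simp only: has_field_derivative_def)
  then have 2: "py f P = D (0, 1)" unfolding py_def P by (simp add: DERIV_imp_deriv)
  have "D v = px f P * fst v + py f P * snd v" for v
  proof -
    have "v = fst v *\<^sub>R (1, 0) + snd v *\<^sub>R (0, 1)" by (simp add: prod_eq_iff)
    then have "D v = fst v *\<^sub>R D (1, 0) + snd v *\<^sub>R D (0, 1)"
      by (metis linear_add[OF lin] linear_scale[OF lin])
    then show ?thesis by (simp add: 1 2)
  qed
  then have "D = (\<lambda>v. px f P * fst v + py f P * snd v)" by blast
  then show ?thesis using D by (simp add: P)
qed

lemma C1_plane_partials:
  assumes "C1_plane f"
  shows "((\<lambda>s. f (s, y)) has_real_derivative px f (x, y)) (at x)"
    and "((\<lambda>t. f (x, t)) has_real_derivative py f (x, y)) (at y)"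
proof -
  have "((\<lambda>s. f (s, y)) has_derivative (\<lambda>h. px f (x, y) * fst (h, 0::real) + py f (x, y) * snd (h, 0::real))) (at x)"
    by (rule has_derivative_compose[where f = "\<lambda>s. (s, y)", OF _ C1_plane_has_derivative[OF assms]])
       (auto intro!: derivative_eq_intros)
  then show "((\<lambda>s. f (s, y)) has_real_derivative px f (x, y)) (at x)"
    by (simp add: has_field_derivative_def)
  have "((\<lambda>t. f (x, t)) has_derivative (\<lambda>h. px f (x, y) * fst (0::real, h) + py f (x, y) * snd (0::real, h))) (at y)"
    by (rule has_derivative_compose[where f = "\<lambda>t. (x, t)", OF _ C1_plane_has_derivative[OF assms]])
       (auto intro!: derivative_eq_intros)
  then show "((\<lambda>t. f (x, t)) has_real_derivative py f (x, y)) (at y)"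
    by (simp add: has_field_derivative_def)
qed

text \<open>The mean value theorem, once in each variable and in both orders, applied to the same
  second difference.\<close>

lemma C2_plane_second_difference:
  assumes "C2_plane u" "h > 0"
  shows "\<exists>s t. x < s \<and> s < x + h \<and> y < t \<and> t < y + h \<and>
      u (x + h, y + h) - u (x, y + h) - u (x + h, y) + u (x, y) = h\<^sup>2 * py (px u) (s, t)"
    and "\<exists>s t. x < s \<and> s < x + h \<and> y < t \<and> t < y + h \<and>
      u (x + h, y + h) - u (x, y + h) - u (x + h, y) + u (x, y) = h\<^sup>2 * px (py u) (s, t)"
proof -
  have C: "C1_plane u" "C1_plane (px u)" "C1_plane (py u)" using assms by (auto simp: C2_plane_def)
  have "\<exists>s>x. s < x + h \<and> (u (x + h, y + h) - u (x + h, y)) - (u (x, y + h) - u (x, y))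
      = (x + h - x) * (px u (s, y + h) - px u (s, y))"
    by (rule MVT2) (use assms in \<open>auto intro!: DERIV_diff C1_plane_partials C\<close>)
  then obtain s where s: "x < s" "s < x + h" "(u (x + h, y + h) - u (x + h, y)) - (u (x, y + h) - u (x, y))
      = h * (px u (s, y + h) - px u (s, y))" by auto
  have "\<exists>t>y. t < y + h \<and> px u (s, y + h) - px u (s, y) = (y + h - y) * py (px u) (s, t)"
    by (rule MVT2) (use assms in \<open>auto intro!: C1_plane_partials C\<close>)
  then obtain t where t: "y < t" "t < y + h" "px u (s, y + h) - px u (s, y) = h * py (px u) (s, t)" by auto
  show "\<exists>s t. x < s \<and> s < x + h \<and> y < t \<and> t < y + h \<and>
      u (x + h, y + h) - u (x, y + h) - u (x + h, y) + u (x, y) = h\<^sup>2 * py (px u) (s, t)"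
    using s t by (intro exI[of _ s] exI[of _ t]) (simp add: power2_eq_square)
  have "\<exists>t>y. t < y + h \<and> (u (x + h, y + h) - u (x, y + h)) - (u (x + h, y) - u (x, y))
      = (y + h - y) * (py u (x + h, t) - py u (x, t))"
    by (rule MVT2) (use assms in \<open>auto intro!: DERIV_diff C1_plane_partials C\<close>)
  then obtain t where t: "y < t" "t < y + h" "(u (x + h, y + h) - u (x, y + h)) - (u (x + h, y) - u (x, y))
      = h * (py u (x + h, t) - py u (x, t))" by auto
  have "\<exists>s>x. s < x + h \<and> py u (x + h, t) - py u (x, t) = (x + h - x) * px (py u) (s, t)"
    by (rule MVT2) (use assms in \<open>auto intro!: C1_plane_partials C\<close>)
  then obtain s where s: "x < s" "s < x + h" "py u (x + h, t) - py u (x, t) = h * px (py u) (s, t)" by auto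
  show "\<exists>s t. x < s \<and> s < x + h \<and> y < t \<and> t < y + h \<and>
      u (x + h, y + h) - u (x, y + h) - u (x + h, y) + u (x, y) = h\<^sup>2 * px (py u) (s, t)"
    using s t by (intro exI[of _ s] exI[of _ t]) (simp add: power2_eq_square)
qed

text \<open>Schwarz's theorem: the second difference makes the two mixed partials agree at two
  points close to \<open>P\<close>, and both are continuous.\<close>

lemma C2_plane_mixed_partials:
  assumes "C2_plane u"
  shows "px (py u) P = py (px u) P"
proof (rule ccontr)
  obtain x y where P: "P = (x, y)" by (cases P)
  \<comment> \<open>Half the supposed distance, so that values within \<open>e\<close> of either
    side cannot coincide.\<close>
  define e where "e = dist (px (py u) P) (py (px u) P) / 2"
  assume "px (py u) P \<noteq> py (px u) P"
  then have e: "e > 0" by (simp add: e_def)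
  have c: "continuous_on UNIV (px (py u))" "continuous_on UNIV (py (px u))"
    using assms by (auto simp: C2_plane_def C1_plane_def)
  obtain d1 where d1: "d1 > 0" "\<And>Z. dist Z P < d1 \<Longrightarrow> dist (px (py u) Z) (px (py u) P) < e"
    using c(1) e unfolding continuous_on_iff by (metis UNIV_I)
  obtain d2 where d2: "d2 > 0" "\<And>Z. dist Z P < d2 \<Longrightarrow> dist (py (px u) Z) (py (px u) P) < e"
    using c(2) e unfolding continuous_on_iff by (metis UNIV_I)
  define h where "h = min d1 d2 / 2"
  have h: "h > 0" "2 * h \<le> d1" "2 * h \<le> d2" using d1 d2 by (auto simp: h_def)
  have near: "dist (s, t) P < 2 * h" if "x < s" "s < x + h" "y < t" "t < y + h" for s t
  proof -
    have "dist (s, t) (x, y) \<le> dist s x + dist t y"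
      unfolding dist_Pair_Pair using sqrt_sum_squares_le_sum[of "dist s x" "dist t y"] by simp
    then show ?thesis using that by (simp add: P dist_real_def)
  qed
  obtain s t where st: "dist (s, t) P < 2 * h"
    "u (x + h, y + h) - u (x, y + h) - u (x + h, y) + u (x, y) = h\<^sup>2 * py (px u) (s, t)"
    using C2_plane_second_difference(1)[OF assms h(1)] near by metis
  obtain s' t' where st': "dist (s', t') P < 2 * h"
    "u (x + h, y + h) - u (x, y + h) - u (x + h, y) + u (x, y) = h\<^sup>2 * px (py u) (s', t')"
    using C2_plane_second_difference(2)[OF assms h(1)] near by metis
  have "py (px u) (s, t) = px (py u) (s', t')" using st st' h by simp
  moreover have "dist (px (py u) (s', t')) (px (py u) P) < e" using d1(2) st' h by force
  moreover have "dist (py (px u) (s, t)) (py (px u) P) < e" using d2(2) st h by force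
  ultimately show False
    using dist_triangle3[of "px (py u) P" "py (px u) P" "px (py u) (s', t')"] by (simp add: e_def)
qed

text \<open>In \<open>curl\<close> the Hessian part cancels by symmetry of the mixed partials. In
  \<open>eqn\<close> the quarter turn pairs \<open>rot F\<close> with an orthogonal vector, and the
  Hessian part is the given equation.\<close>

lemma p_minimal_C2_plane:
  assumes C2: "C2_plane u"
    and eqn: "\<forall>x y.
      (py u (x, y) + x)^2 * px (px u) (x, y)
      - 2 * (py u (x, y) + x) * (px u (x, y) - y) * py (px u) (x, y)
      + (px u (x, y) - y)^2 * py (py u) (x, y) = 0"
  shows "p_minimal u (\<lambda>P. (px u P - snd P, py u P + fst P))
    (\<lambda>P v. (px (px u) P * fst v + py (px u) P * snd v - snd v,
      px (py u) P * fst v + py (py u) P * snd v + fst v))"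
proof
  have C: "C1_plane u" "C1_plane (px u)" "C1_plane (py u)" using C2 by (auto simp: C2_plane_def)
  fix P
  show "(u has_derivative (\<lambda>v. (px u P - snd P, py u P + fst P) \<bullet> v - cross2 P v)) (at P)"
    using C1_plane_has_derivative[OF C(1), of P]
    by (simp add: inner_pair cross2_def algebra_simps)
  show "((\<lambda>P. (px u P - snd P, py u P + fst P)) has_derivative
     (\<lambda>v. (px (px u) P * fst v + py (px u) P * snd v - snd v,
      px (py u) P * fst v + py (py u) P * snd v + fst v))) (at P)"
    by (intro has_derivative_Pair has_derivative_diff has_derivative_add
        C1_plane_has_derivative C has_derivative_fst has_derivative_snd has_derivative_ident)
  show "continuous_on UNIV (\<lambda>P. (px (px u) P * fst v + py (px u) P * snd v - snd v,
      px (py u) P * fst v + py (py u) P * snd v + fst v))" for v :: "real \<times> real"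
    using C(2,3) unfolding C1_plane_def by (auto intro!: continuous_intros)
  show "w \<bullet> (px (px u) P * fst v + py (px u) P * snd v - snd v,
      px (py u) P * fst v + py (py u) P * snd v + fst v)
    - v \<bullet> (px (px u) P * fst w + py (px u) P * snd w - snd w,
      px (py u) P * fst w + py (py u) P * snd w + fst w) = 2 * cross2 v w" for v w :: "real \<times> real"
    by (simp add: C2_plane_mixed_partials[OF C2] inner_pair cross2_def algebra_simps)
  have *: "(py u P + fst P)^2 * px (px u) P
      - 2 * (py u P + fst P) * (px u P - snd P) * py (px u) P
      + (px u P - snd P)^2 * py (py u) P = 0"
    using eqn[rule_format, of "fst P" "snd P"] by simp
  show "rot (px u P - snd P, py u P + fst P) \<bullet>
     (px (px u) P * fst (rot (px u P - snd P, py u P + fst P))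
        + py (px u) P * snd (rot (px u P - snd P, py u P + fst P))
        - snd (rot (px u P - snd P, py u P + fst P)),
      px (py u) P * fst (rot (px u P - snd P, py u P + fst P))
        + py (py u) P * snd (rot (px u P - snd P, py u P + fst P))
        + fst (rot (px u P - snd P, py u P + fst P))) = 0"
    by (subst *[symmetric])
       (simp add: C2_plane_mixed_partials[OF C2] inner_pair rot_def power2_eq_square algebra_simps)
qed

theorem theoremA:
  fixes u :: "real \<times> real \<Rightarrow> real"
  assumes "C2_plane u"
    and "\<forall>x y.
      (py u (x, y) + x)^2 * px (px u) (x, y)
      - 2 * (py u (x, y) + x) * (px u (x, y) - y) * py (px u) (x, y)
      + (px u (x, y) - y)^2 * py (py u) (x, y) = 0"
  shows "(\<exists>a b c. \<forall>x y. u (x, y) = a * x + b * y + c) \<or>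
         (\<exists>a b g. a^2 + b^2 = 1 \<and> C2_line g \<and>
            (\<forall>x y. u (x, y) = - a * b * x^2 + (a^2 - b^2) * x * y + a * b * y^2
                              + g (- b * x + a * y)))"
  using p_minimal.classification[OF p_minimal_C2_plane[OF assms]] .

end
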